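(* Let $Q \subset \mathbb{R}^n$, $n \ge 2$, be a real quadric surface. Then the complement $\mathbb{R}^n \setminus Q$ is the union of four or fewer open sets, namely its connected components. At least one of these sets is convex if and only if the canonical form of $Q$ is given by one of the equations \begin{align*} & a_1 \xi_1^2 + \cdots + a_k \xi_k^2 = 1, \quad 1 \le k \le n, \\ & a_1 \xi_1^2 - a_2 \xi_2^2 - \cdots - a_k \xi_k^2 = 1, \quad 2 \le k \le n, \\ & a_1 \xi_1^2 = 0, \\ & a_1 \xi_1^2 - a_2 \xi_2^2 - \cdots - a_k \xi_k^2 = 0, \quad 2 \le k \le n, \\ & a_1 \xi_1^2 + \cdots + a_{k-1} \xi_{k-1}^2 = \xi_k, \quad 2 \le k \le n, \end{align*} where all scalars $a_i$ involved are positive; that is, if and only if there are Cartesian coordinates $\xi_1, \dots, \xi_n$ on $\mathbb{R}^n$ in which $Q$ is the set of points satisfying one of these equations for some positive scalars $a_i$.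
   Context: A quadric surface in $\mathbb{R}^n$, $n\ge 2$, is the locus of points $x=(\xi_1,\dots,\xi_n)$ satisfying an equation $\sum_{i,k=1}^n a_{ik}\xi_i\xi_k + 2\sum_{i=1}^n b_i\xi_i + c = 0$ with real coefficients, where not all $a_{ik}$ are zero. It is called real if this locus (in $\mathbb{R}^n$) is nonempty. Cartesian coordinates are coordinates with respect to some origin and some orthonormal basis. *)

theory Defs
  imports "HOL-Analysis.Analysis"
begin

text \<open>
  The coefficient matrix is not assumed symmetric.
\<close>

definition quadric_locus :: "real^'n^'n \<Rightarrow> real^'n \<Rightarrow> real \<Rightarrow> (real^'n) set" where
  "quadric_locus A b c =
    {x. (\<Sum>i\<in>UNIV. \<Sum>k\<in>UNIV. A $ i $ k * x $ i * x $ k)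
        + 2 * (\<Sum>i\<in>UNIV. b $ i * x $ i) + c = 0}"

definition quadric_surface :: "(real^'n) set \<Rightarrow> bool" where
  "quadric_surface Q \<longleftrightarrow>
    (\<exists>A b c. (\<exists>i k. A $ i $ k \<noteq> 0) \<and> Q = quadric_locus A b c)"

definition real_quadric_surface :: "(real^'n) set \<Rightarrow> bool" where
  "real_quadric_surface Q \<longleftrightarrow> quadric_surface Q \<and> Q \<noteq> {}"

text \<open>
  A basis is listed as \<open>e 1, \<dots>, e n\<close> with \<open>n = CARD('n)\<close>, so that the canonical
  equations can refer to the first \<open>k\<close> coordinates; values of \<open>e\<close> at other
  indices are irrelevant.
\<close>

definition orthonormal_basis :: "(nat \<Rightarrow> real^'n) \<Rightarrow> bool" where
  "orthonormal_basis e \<longleftrightarrow>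
    (\<forall>i\<in>{1..CARD('n)}. \<forall>j\<in>{1..CARD('n)}. e i \<bullet> e j = (if i = j then 1 else 0)) \<and>
    span (e ` {1..CARD('n)}) = UNIV"

definition cartesian_coord :: "real^'n \<Rightarrow> (nat \<Rightarrow> real^'n) \<Rightarrow> nat \<Rightarrow> real^'n \<Rightarrow> real" where
  "cartesian_coord p e i x = (x - p) \<bullet> e i"

definition cartesian_coordinates :: "(nat \<Rightarrow> real^'n \<Rightarrow> real) \<Rightarrow> bool" where
  "cartesian_coordinates \<xi> \<longleftrightarrow>
    (\<exists>p e. orthonormal_basis e \<and> \<xi> = cartesian_coord p e)"

end

theory Submission
  imports Defs
begin

text \<open>
  Write the quadric as \<open>f = 0\<close> with \<open>f x = x \<bullet> S x + 2 b \<bullet> x + c\<close> and \<open>S\<close> self-adjoint. If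
  \<open>w \<bullet> S w > 0\<close>, two points with \<open>f > 0\<close> at which the derivative of \<open>f\<close> along \<open>w\<close> has the same
  sign are joined inside \<open>f > 0\<close> by pushing them far in the direction of \<open>w\<close> or \<open>- w\<close>; if there is
  no such \<open>w\<close>, then \<open>f\<close> is concave. So each of \<open>f > 0\<close> and \<open>f < 0\<close> has at most two components.

  If \<open>f > 0\<close> is connected and a positive direction exists, then \<open>f > 0\<close> is not convex, because a line
  through a point of the quadric in that direction has both ends in it. In canonical form this
  applies when there are two positive eigenvalues, and when there is one and \<open>f\<close> has a linear term
  or a positive constant term. In the remaining canonical forms either \<open>f > 0\<close> is empty or the
  equation is a listed one.

  Conversely, each listed quadric can be written \<open>\<Sum>\<^sub>i (h i)\<^sup>2 = g\<^sup>2\<close> with affine \<open>h i\<close> and \<open>g\<close>, and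
  the solid cone where \<open>g\<close> exceeds the Euclidean norm of \<open>h\<close> is a convex component.
\<close>

subsection \<open>Quadratic functions\<close>

text \<open>For self-adjoint \<open>S\<close> the factor 2 makes \<open>S x + b\<close> half the
  gradient at \<open>x\<close>.\<close>

definition quad :: "('a::euclidean_space \<Rightarrow> 'a) \<Rightarrow> 'a \<Rightarrow> real \<Rightarrow> 'a \<Rightarrow> real" where
  "quad S b c x = x \<bullet> S x + 2 * (b \<bullet> x) + c"

definition selfadjoint :: "('a::euclidean_space \<Rightarrow> 'a) \<Rightarrow> bool" where
  "selfadjoint S \<longleftrightarrow> linear S \<and> (\<forall>x y. S x \<bullet> y = x \<bullet> S y)"

text \<open>
  Vectors are collected in sets here; a numbering is chosen only when the coordinates of the
  canonical equations are written down.
\<close>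

definition orthonormal :: "'a::euclidean_space set \<Rightarrow> bool" where
  "orthonormal B \<longleftrightarrow> pairwise orthogonal B \<and> (\<forall>v\<in>B. norm v = 1)"

lemma quad_uminus: "quad (\<lambda>x. - S x) (- b) (- c) x = - quad S b c x"
  by (simp add: quad_def)

lemma selfadjoint_uminus: "selfadjoint S \<Longrightarrow> selfadjoint (\<lambda>x. - S x)"
  by (simp add: selfadjoint_def linear_compose_neg)

text \<open>The exact second-order Taylor expansion along a line; self-adjointness merges the two
  mixed terms.\<close>

lemma quad_along:
  assumes "selfadjoint S"
  shows "quad S b c (x + t *\<^sub>R w) = quad S b c x + 2 * t * ((S x + b) \<bullet> w) + t\<^sup>2 * (w \<bullet> S w)"
proof -
  have "S (x + t *\<^sub>R w) = S x + t *\<^sub>R S w"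
    using assms by (simp add: selfadjoint_def linear_add linear_cmul)
  moreover have "x \<bullet> S w = S x \<bullet> w" using assms by (simp add: selfadjoint_def)
  ultimately show ?thesis
    by (simp add: quad_def inner_simps inner_commute algebra_simps power2_eq_square)
qed

text \<open>On a line the function is a quadratic polynomial in \<open>t\<close>, fixed by two
  values and its leading coefficient. A negative semidefinite form thus makes it concave.\<close>

lemma quad_convex_combination:
  assumes "selfadjoint S"
  shows "quad S b c ((1 - t) *\<^sub>R x + t *\<^sub>R y)
    = (1 - t) * quad S b c x + t * quad S b c y - t * (1 - t) * ((y - x) \<bullet> S (y - x))"
proof -
  have "quad S b c (x + 1 *\<^sub>R (y - x)) = quad S b c y"
    "x + t *\<^sub>R (y - x) = (1 - t) *\<^sub>R x + t *\<^sub>R y" by (simp_all add: algebra_simps)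
  \<comment> \<open>The common slope \<open>g\<close> is eliminated between the expansions at the
    parameters 1 and \<open>t\<close>.\<close>
  moreover have "f1 = f0 + 2 * 1 * g + 1\<^sup>2 * h \<Longrightarrow> ft = f0 + 2 * t * g + t\<^sup>2 * h
      \<Longrightarrow> ft = (1 - t) * f0 + t * f1 - t * (1 - t) * h" for f0 f1 ft g h :: real
    by (simp add: algebra_simps power2_eq_square)
  ultimately show ?thesis
    using quad_along[OF assms, of b c x 1 "y - x"] quad_along[OF assms, of b c x t "y - x"]
    by metis
qed

lemma continuous_on_quad:
  assumes "selfadjoint S" shows "continuous_on U (quad S b c)"
proof -
  have "continuous_on U S"
    using assms by (simp add: selfadjoint_def linear_continuous_on linear_conv_bounded_linear)
  then show ?thesis
    unfolding quad_def by (intro continuous_intros)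
qed

lemma connected_component_closed_segment:
  fixes x y :: "'a::real_normed_vector"
  assumes "closed_segment x y \<subseteq> U"
  shows "connected_component U x y"
  unfolding connected_component_def
  using assms by (intro exI[of _ "closed_segment x y"]) (auto simp: connected_segment)

subsection \<open>Components of the complement\<close>

text \<open>
  Pushing both points far along \<open>w\<close> keeps the function positive on the way, and eventually on the
  whole translated segment between them.
\<close>

lemma quad_pos_connected_component:
  assumes S: "selfadjoint S"
    and x: "quad S b c x > 0" "(S x + b) \<bullet> w \<ge> \<kappa>"
    and y: "quad S b c y > 0" "(S y + b) \<bullet> w \<ge> \<kappa>"
    and w: "w \<bullet> S w \<ge> 0" "\<kappa> \<ge> 0" "\<kappa> + w \<bullet> S w > 0"
  shows "connected_component {z. quad S b c z > 0} x y"
proof -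
  let ?f = "quad S b c" and ?U = "{z. quad S b c z > 0}"
  have lin: "linear S" using S by (simp add: selfadjoint_def)
  have up: "closed_segment z (z + T *\<^sub>R w) \<subseteq> ?U"
    if "?f z > 0" "(S z + b) \<bullet> w \<ge> \<kappa>" "T \<ge> 0" for z T
  proof
    fix z' assume "z' \<in> closed_segment z (z + T *\<^sub>R w)"
    then obtain u where u: "0 \<le> u" "z' = (1 - u) *\<^sub>R z + u *\<^sub>R (z + T *\<^sub>R w)"
      by (auto simp: in_segment)
    then have "z' = z + (u * T) *\<^sub>R w" by (simp add: algebra_simps)
    then show "z' \<in> ?U"
      using that u w by (auto simp: quad_along[OF S] intro!: add_pos_nonneg)
  qed
  have "compact (?f ` closed_segment x y)"
    by (intro compact_continuous_image continuous_on_quad S compact_segment)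
  then obtain m where m: "\<And>z. z \<in> closed_segment x y \<Longrightarrow> m \<le> ?f z"
    by (meson compact_imp_bounded bounded_imp_bdd_below bdd_below_def imageI)
  \<comment> \<open>\<open>T \<ge> 1\<close> gives \<open>T * T \<ge> T\<close>, so translating by
    \<open>T\<close> gains at least \<open>T * (\<kappa> + w \<bullet> S w)\<close>, more than
    \<open>\<bar>m\<bar>\<close>. The growth may come from the form, with
    \<open>\<kappa> = 0\<close>, or from the linear part, with
    \<open>w \<bullet> S w = 0\<close>.\<close>
  define T where "T = 1 + \<bar>m\<bar> / (\<kappa> + w \<bullet> S w)"
  have T: "T \<ge> 1" "T * (\<kappa> + w \<bullet> S w) > \<bar>m\<bar>"
    using w by (simp_all add: T_def distrib_right[of 1])
  have "closed_segment (x + T *\<^sub>R w) (y + T *\<^sub>R w) \<subseteq> ?U"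
  proof
    fix z' assume "z' \<in> closed_segment (x + T *\<^sub>R w) (y + T *\<^sub>R w)"
    then obtain u where u: "0 \<le> u" "u \<le> 1"
      and "z' = (1 - u) *\<^sub>R (x + T *\<^sub>R w) + u *\<^sub>R (y + T *\<^sub>R w)"
      by (auto simp: in_segment)
    define z where "z = (1 - u) *\<^sub>R x + u *\<^sub>R y"
    have z': "z' = z + T *\<^sub>R w"
      using \<open>z' = _\<close> by (simp add: z_def algebra_simps)
    \<comment> \<open>The half gradient is affine, so its lower bound at the ends holds on the whole
      segment.\<close>
    have "(S z + b) \<bullet> w = (1 - u) * ((S x + b) \<bullet> w) + u * ((S y + b) \<bullet> w)"
      unfolding z_def linear_add[OF lin] linear_cmul[OF lin]
      by (simp add: inner_simps algebra_simps)
    also have "\<dots> \<ge> (1 - u) * \<kappa> + u * \<kappa>"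
      using x y u by (intro add_mono mult_left_mono) auto
    finally have grad: "(S z + b) \<bullet> w \<ge> \<kappa>" by (simp add: algebra_simps)
    have "m \<le> ?f z" using m u by (auto simp: z_def in_segment)
    moreover have "T * \<kappa> \<le> 2 * T * ((S z + b) \<bullet> w)"
    proof -
      have "T * \<kappa> \<le> T * ((S z + b) \<bullet> w)" using grad T by (intro mult_left_mono) auto
      moreover have "0 \<le> T * \<kappa>" using T w by auto
      ultimately show ?thesis by simp
    qed
    moreover have "T * (w \<bullet> S w) \<le> T\<^sup>2 * (w \<bullet> S w)"
      using T w by (intro mult_right_mono) (auto simp: power2_eq_square)
    ultimately show "z' \<in> ?U"
      using T(2) unfolding z' by (simp add: quad_along[OF S] distrib_left)
  qed
  moreover have "closed_segment (y + T *\<^sub>R w) y \<subseteq> ?U"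
    using up[OF y, of T] T by (simp add: closed_segment_commute)
  ultimately show ?thesis
    using up[OF x, of T] T
    by (meson connected_component_closed_segment connected_component_trans order_trans zero_le_one)
qed

text \<open>The pieces are cut out by the sign of the derivative along a positive direction
  \<open>w\<close>; without such a direction the positive set is convex and one piece is empty. The
  pieces may overlap, and points are only joined inside the whole positive set, which suffices for
  counting components.\<close>

lemma quad_pos_two_pieces:
  assumes S: "selfadjoint S"
  obtains G H where "{z. quad S b c z > 0} = G \<union> H"
    "\<And>x y. x \<in> G \<Longrightarrow> y \<in> G \<Longrightarrow> connected_component {z. quad S b c z > 0} x y"
    "\<And>x y. x \<in> H \<Longrightarrow> y \<in> H \<Longrightarrow> connected_component {z. quad S b c z > 0} x y"
proof (cases "\<exists>w. w \<bullet> S w > 0")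
  case True
  then obtain w where w: "w \<bullet> S w > 0" by blast
  have nw: "- w \<bullet> S (- w) > 0"
    using w S by (simp add: selfadjoint_def linear_neg)
  show ?thesis
  proof
    show "{z. quad S b c z > 0} = {z. quad S b c z > 0 \<and> (S z + b) \<bullet> w \<ge> 0} \<union>
        {z. quad S b c z > 0 \<and> (S z + b) \<bullet> - w \<ge> 0}" by auto
  qed (use quad_pos_connected_component[OF S, of b c _ 0 w] w
      quad_pos_connected_component[OF S, of b c _ 0 "- w"] nw in auto)
next
  case False
  then have conc: "z \<bullet> S z \<le> 0" for z by (meson not_le)
  have "connected_component {z. quad S b c z > 0} x y"
    if "quad S b c x > 0" "quad S b c y > 0" for x y
  proof (rule connected_component_closed_segment, rule)
    fix z assume "z \<in> closed_segment x y"
    then obtain t where t: "0 \<le> t" "t \<le> 1" "z = (1 - t) *\<^sub>R x + t *\<^sub>R y"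
      by (auto simp: in_segment)
    have "t * (1 - t) * ((y - x) \<bullet> S (y - x)) \<le> 0"
      using t conc[of "y - x"] by (simp add: mult_nonneg_nonpos)
    moreover have "(1 - t) * quad S b c x + t * quad S b c y > 0"
    proof (cases "t = 0")
      case False
      then show ?thesis using t that by (intro add_nonneg_pos) auto
    qed (use that in auto)
    ultimately show "z \<in> {z. quad S b c z > 0}"
      unfolding t(3) mem_Collect_eq quad_convex_combination[OF S] by linarith
  qed
  then show ?thesis
    by (intro that[of "{z. quad S b c z > 0}" "{}"]) auto
qed

text \<open>Every component meets a member of the cover, and each member lies in a single component,
  so one point per member reaches all components.\<close>

lemma card_components_le:
  assumes F: "finite F" "U = \<Union>F"
    and conn: "\<And>D x y. \<lbrakk>D \<in> F; x \<in> D; y \<in> D\<rbrakk> \<Longrightarrow> connected_component U x y"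
  shows "finite (components U)" "card (components U) \<le> card F"
proof -
  \<comment> \<open>For an empty \<open>D\<close> the chosen point is arbitrary; this is harmless
    because only an inclusion into the image is shown.\<close>
  let ?r = "\<lambda>D. connected_component_set U (SOME x. x \<in> D)"
  have sub: "components U \<subseteq> ?r ` F"
  proof
    fix C assume "C \<in> components U"
    then obtain x where x: "x \<in> U" "C = connected_component_set U x"
      by (auto simp: components_def)
    then obtain D where D: "D \<in> F" "x \<in> D" using F by auto
    then have "connected_component U x (SOME x. x \<in> D)"
      by (intro conn[of D]) (auto intro: someI)
    then have "C = ?r D" using x connected_component_eq_eq by (metis connected_component_in)
    then show "C \<in> ?r ` F" using D by auto
  qed
  then show "finite (components U)" using F finite_subset by blast
  show "card (components U) \<le> card F"
    using sub F by (meson card_image_le card_mono finite_imageI order_trans)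
qed

text \<open>Two pieces cover the positive region and, after negating all data, two cover the
  negative one. Pieces may coincide, hence only an inequality.\<close>

lemma quad_nonzero_components:
  assumes S: "selfadjoint S"
  shows "finite (components {z. quad S b c z \<noteq> 0})" "card (components {z. quad S b c z \<noteq> 0}) \<le> 4"
proof -
  let ?f = "quad S b c"
  obtain G1 H1 where 1: "{z. ?f z > 0} = G1 \<union> H1"
    "\<And>x y. x \<in> G1 \<Longrightarrow> y \<in> G1 \<Longrightarrow> connected_component {z. ?f z > 0} x y"
    "\<And>x y. x \<in> H1 \<Longrightarrow> y \<in> H1 \<Longrightarrow> connected_component {z. ?f z > 0} x y"
    using quad_pos_two_pieces[OF S] by metis
  obtain G2 H2 where 2: "{z. ?f z < 0} = G2 \<union> H2"
    "\<And>x y. x \<in> G2 \<Longrightarrow> y \<in> G2 \<Longrightarrow> connected_component {z. ?f z < 0} x y"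
    "\<And>x y. x \<in> H2 \<Longrightarrow> y \<in> H2 \<Longrightarrow> connected_component {z. ?f z < 0} x y"
    using quad_pos_two_pieces[OF selfadjoint_uminus[OF S], of "- b" "- c"]
    unfolding quad_uminus neg_0_less_iff_less by metis
  let ?F = "{G1, H1, G2, H2}"
  have U: "{z. ?f z \<noteq> 0} = \<Union>?F"
    using 1(1) 2(1) by (auto simp: neq_iff)
  have conn: "connected_component {z. ?f z \<noteq> 0} x y" if "D \<in> ?F" "x \<in> D" "y \<in> D" for D x y
    using that 1(2,3) 2(2,3)
    by (auto intro: connected_component_of_subset[of "{z. ?f z > 0}"]
        connected_component_of_subset[of "{z. ?f z < 0}"])
  have c4: "card ?F \<le> 4" by (simp add: card_insert_if)
  show "finite (components {z. ?f z \<noteq> 0})"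
    by (rule card_components_le(1)[OF _ U conn]) auto
  have "card (components {z. ?f z \<noteq> 0}) \<le> card ?F"
    by (rule card_components_le(2)[OF _ U conn]) auto
  then show "card (components {z. ?f z \<noteq> 0}) \<le> 4" using c4 by linarith
qed

text \<open>A parabola through the origin that is nowhere positive has its maximum there, so its
  slope vanishes. This is the first-order condition behind the existence of eigenvectors.\<close>

lemma zero_if_quadratic_nonpos:
  fixes \<alpha> \<beta> :: real
  assumes "\<And>t. 2 * t * \<alpha> + t\<^sup>2 * \<beta> \<le> 0"
  shows "\<alpha> = 0"
proof (rule ccontr)
  assume "\<alpha> \<noteq> 0"
  \<comment> \<open>With this \<open>t\<close> the linear term is
    \<open>2 * t\<^sup>2 * (\<bar>\<beta>\<bar> + 1)\<close>, which outweighs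
    \<open>t\<^sup>2 * \<beta>\<close>.\<close>
  define t where "t = \<alpha> / (\<bar>\<beta>\<bar> + 1)"
  have a: "\<alpha> = t * (\<bar>\<beta>\<bar> + 1)" by (simp add: t_def)
  with \<open>\<alpha> \<noteq> 0\<close> have "t\<^sup>2 > 0" by auto
  have "2 * t * \<alpha> + t\<^sup>2 * \<beta> = t\<^sup>2 * (2 * (\<bar>\<beta>\<bar> + 1) + \<beta>)"
    by (subst a) (simp add: power2_eq_square algebra_simps)
  also have "\<dots> > 0" using \<open>t\<^sup>2 > 0\<close> by (intro mult_pos_pos) auto
  finally show False using assms[of t] by simp
qed

subsection \<open>Canonical forms\<close>

text \<open>
  A unit vector maximising \<open>x \<bullet> S x\<close> on the invariant subspace is an eigenvector.
\<close>

lemma selfadjoint_eigenvector: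
  assumes S: "selfadjoint S" and V: "subspace V" "\<And>x. x \<in> V \<Longrightarrow> S x \<in> V" and ne: "\<not> V \<subseteq> {0}"
  obtains v l where "v \<in> V" "norm v = 1" "S v = l *\<^sub>R v"
proof -
  let ?K = "V \<inter> sphere 0 1"
  have lin: "linear S" using S by (simp add: selfadjoint_def)
  obtain x where x: "x \<in> V" "x \<noteq> 0" using ne by auto
  then have "x /\<^sub>R norm x \<in> ?K" using V by (auto intro: subspace_scale)
  moreover have "compact ?K"
    by (simp add: V closed_subspace closed_Int_compact)
  moreover have "continuous_on ?K (quad S 0 0)" by (rule continuous_on_quad[OF S])
  ultimately obtain v where v: "v \<in> ?K" "\<And>y. y \<in> ?K \<Longrightarrow> quad S 0 0 y \<le> quad S 0 0 v"
    by (metis continuous_attains_sup empty_iff)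
  define l where "l = v \<bullet> S v"
  \<comment> \<open>Homogeneity carries the maximum on the unit sphere over to all of
    \<open>V\<close>.\<close>
  have bound: "y \<bullet> S y \<le> l * (norm y)\<^sup>2" if "y \<in> V" for y
  proof (cases "y = 0")
    case False
    then have "y /\<^sub>R norm y \<in> ?K" using V that by (auto intro: subspace_scale)
    from v(2)[OF this] have "(y \<bullet> S y) / (norm y)\<^sup>2 \<le> l"
      using False by (simp add: quad_def l_def linear_cmul[OF lin] power2_eq_square divide_simps)
    then show ?thesis using False by (simp add: divide_simps)
  qed simp
  \<comment> \<open>The residual of the eigenvalue equation. Perturbing \<open>v\<close> along it
    turns the bound into a nonpositive parabola with slope \<open>?u \<bullet> ?u\<close>.\<close>
  let ?u = "S v - l *\<^sub>R v"
  have u: "?u \<in> V" using v V by (auto intro: subspace_diff subspace_scale)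
  have nv: "v \<bullet> v = 1" using v by (simp add: norm_eq_1)
  have "2 * t * (?u \<bullet> ?u) + t\<^sup>2 * (?u \<bullet> S ?u - l * (?u \<bullet> ?u)) \<le> 0" for t
  proof -
    have "v + t *\<^sub>R ?u \<in> V" using u v V by (auto intro: subspace_add subspace_scale)
    from bound[OF this]
    have "quad S 0 0 (v + t *\<^sub>R ?u) \<le> l * ((v + t *\<^sub>R ?u) \<bullet> (v + t *\<^sub>R ?u))"
      by (simp add: quad_def power2_norm_eq_inner)
    also have "(v + t *\<^sub>R ?u) \<bullet> (v + t *\<^sub>R ?u) = 1 + 2 * t * (v \<bullet> ?u) + t\<^sup>2 * (?u \<bullet> ?u)"
    proof -
      have "(v + t *\<^sub>R u) \<bullet> (v + t *\<^sub>R u) = 1 + 2 * t * (v \<bullet> u) + t\<^sup>2 * (u \<bullet> u)" for u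
        using nv by (simp add: inner_simps inner_commute[of u v] power2_eq_square algebra_simps)
      then show ?thesis .
    qed
    finally have "2 * t * (S v \<bullet> ?u - l * (v \<bullet> ?u)) + t\<^sup>2 * (?u \<bullet> S ?u - l * (?u \<bullet> ?u)) \<le> 0"
      unfolding quad_along[OF S] by (simp add: quad_def l_def[symmetric] algebra_simps)
    moreover have "S v \<bullet> ?u - l * (v \<bullet> ?u) = ?u \<bullet> ?u"
      by (simp only: inner_diff_left inner_scaleR_left)
    ultimately show ?thesis by simp
  qed
  then have "?u \<bullet> ?u = 0" by (rule zero_if_quadratic_nonpos)
  then have "S v = l *\<^sub>R v" by simp
  then show ?thesis using that v by auto
qed

lemma orthonormal_insert:
  assumes "orthonormal B" "norm v = 1" "\<And>u. u \<in> B \<Longrightarrow> u \<bullet> v = 0"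
  shows "orthonormal (insert v B)"
  using assms by (auto simp: orthonormal_def pairwise_insert orthogonal_def inner_commute)

text \<open>Subtracting its component along \<open>v\<close> moves a vector of \<open>V\<close> into
  the orthogonal complement of \<open>v\<close>.\<close>

lemma span_insert_orthogonal_complement:
  assumes V: "subspace V" and v: "v \<in> V" "norm v = 1" and B: "span B = {x \<in> V. x \<bullet> v = 0}"
  shows "span (insert v B) = V"
proof
  have "B \<subseteq> V" using B span_superset[of B] by auto
  then show "span (insert v B) \<subseteq> V" using V v by (simp add: span_minimal)
  show "V \<subseteq> span (insert v B)"
  proof
    fix x assume "x \<in> V"
    have "v \<bullet> v = 1" using v by (simp add: norm_eq_1)
    then have "x - (x \<bullet> v) *\<^sub>R v \<in> span B"
      unfolding B using \<open>x \<in> V\<close> v V by (auto intro: subspace_diff subspace_scale simp: inner_simps)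
    then show "x \<in> span (insert v B)" by (auto simp: span_insert)
  qed
qed

text \<open>The spectral theorem, by induction on the dimension: self-adjointness makes the
  orthogonal complement of an eigenvector in \<open>V\<close> invariant again. The form for
  invariant subspaces serves the induction and also the hyperplane orthogonal to a linear
  term.\<close>

lemma selfadjoint_orthonormal_eigenbasis:
  assumes S: "selfadjoint S" and V: "subspace V" "\<And>x. x \<in> V \<Longrightarrow> S x \<in> V"
  shows "\<exists>B. orthonormal B \<and> span B = V \<and> (\<forall>v\<in>B. \<exists>l. S v = l *\<^sub>R v)"
  using V
proof (induction "dim V" arbitrary: V rule: less_induct)
  case less
  show ?case
  proof (cases "V \<subseteq> {0}")
    case True
    then have "V = {0}" using less.prems subspace_0 by blast
    then show ?thesis by (intro exI[of _ "{}"]) (auto simp: orthonormal_def)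
  next
    case False
    then obtain v l where v: "v \<in> V" "norm v = 1" "S v = l *\<^sub>R v"
      using selfadjoint_eigenvector[OF S less.prems] by metis
    let ?W = "{x \<in> V. x \<bullet> v = 0}"
    have W: "subspace ?W"
      using less.prems(1) by (simp add: subspace_def inner_simps)
    have inv: "S x \<in> ?W" if "x \<in> ?W" for x
      using that less.prems(2) S v(3) by (auto simp: selfadjoint_def)
    have "v \<notin> ?W" using v by auto
    then have "?W \<subset> V" using v(1) by blast
    then have "dim ?W < dim V"
      using W less.prems(1) by (intro dim_psubset) (simp only: span_eq_iff[THEN iffD2])
    from less.hyps[OF this W inv] obtain B
      where B: "orthonormal B" "span B = ?W" "\<forall>v\<in>B. \<exists>l. S v = l *\<^sub>R v" by blast
    have "B \<subseteq> ?W" using B(2) span_superset[of B] by simp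
    then have "orthonormal (insert v B)"
      using v(2) by (intro orthonormal_insert B(1)) auto
    moreover have "span (insert v B) = V"
      by (rule span_insert_orthogonal_complement[OF less.prems(1) v(1,2) B(2)])
    moreover have "\<forall>u\<in>insert v B. \<exists>l. S u = l *\<^sub>R u"
      using B(3) v(3) by blast
    ultimately show ?thesis by blast
  qed
qed

section \<open>Orthonormal bases and reduction to canonical form\<close>

lemma orthonormal_inner:
  assumes "orthonormal B" "u \<in> B" "v \<in> B"
  shows "u \<bullet> v = (if u = v then 1 else 0)"
  using assms by (auto simp: orthonormal_def pairwise_def orthogonal_def norm_eq_1)

lemma orthonormal_independent: "orthonormal B \<Longrightarrow> independent B"
  unfolding orthonormal_def by (intro pairwise_orthogonal_independent) auto

lemma finite_orthonormal: "orthonormal B \<Longrightarrow> finite B"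
  by (simp add: independent_imp_finite orthonormal_independent)

lemma card_orthonormal_basis:
  fixes B :: "'a::euclidean_space set"
  assumes "orthonormal B" "span B = UNIV"
  shows "card B = DIM('a)"
  using assms dim_eq_card_independent[OF orthonormal_independent] by (metis dim_UNIV dim_span)

lemma quadratic_form_eigenbasis:
  assumes B: "orthonormal B" "span B = UNIV" and "linear S" "\<And>v. v \<in> B \<Longrightarrow> S v = l v *\<^sub>R v"
  shows "x \<bullet> S x = (\<Sum>v\<in>B. l v * (x \<bullet> v)\<^sup>2)"
proof -
  have "x = (\<Sum>v\<in>B. (x \<bullet> v) *\<^sub>R v)"
    using B finite_orthonormal[OF B(1)] orthonormal_basis_expand[of B x]
    by (simp add: orthonormal_def)
  then have "S x = S (\<Sum>v\<in>B. (x \<bullet> v) *\<^sub>R v)" by simp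
  also have "\<dots> = (\<Sum>v\<in>B. (x \<bullet> v) *\<^sub>R l v *\<^sub>R v)"
    using assms(3,4) by (simp add: linear_sum linear_cmul)
  finally show ?thesis
    by (simp add: inner_sum_right power2_eq_square algebra_simps)
qed

text \<open>Split \<open>b\<close> into a part in the range of \<open>S\<close> and a part
  \<open>k\<close> orthogonal to it, hence in the kernel. Completing the square removes the first
  part; if \<open>k\<close> is nonzero, a shift along it absorbs the constant. The value
  \<open>b \<bullet> w\<close> is recorded to control the derivative along \<open>w\<close>.\<close>

lemma quad_canonical_form:
  assumes S: "selfadjoint S"
  obtains p B l where "orthonormal B" "span B = UNIV" "\<And>v. v \<in> B \<Longrightarrow> S v = l v *\<^sub>R v"
    "(\<exists>\<gamma>. \<forall>x. quad S b c (p + x) = x \<bullet> S x + \<gamma>) \<or>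
     (\<exists>w\<in>B. \<exists>\<beta>>0. S w = 0 \<and> b \<bullet> w = \<beta> \<and> (\<forall>x. quad S b c (p + x) = x \<bullet> S x + 2 * \<beta> * (x \<bullet> w)))"
proof -
  have lin: "linear S" and adj: "\<And>x y. S x \<bullet> y = x \<bullet> S y"
    using S by (auto simp: selfadjoint_def)
  have "subspace (range S)" using lin by (simp add: linear_subspace_image)
  then obtain y k where y: "y \<in> range S" and k: "\<And>r. r \<in> range S \<Longrightarrow> orthogonal k r" and b: "b = y + k"
    using orthogonal_subspace_decomp_exists[of "range S" b] by (metis span_eq_iff)
  obtain u where u: "y = S u" using y by blast
  \<comment> \<open>By self-adjointness this is the product of \<open>k\<close> with
    \<open>S (S k)\<close>, a vector of the range.\<close>
  have "S k \<bullet> S k = 0" using k[of "S (S k)"] by (simp add: adj orthogonal_def)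
  then have Sk: "S k = 0" by simp
  \<comment> \<open>At the point \<open>- u\<close> the half gradient \<open>S x + b\<close> reduces
    to \<open>k\<close>.\<close>
  define \<gamma> where "\<gamma> = quad S b c (- u)"
  have shift: "quad S b c (- u + x) = x \<bullet> S x + 2 * (k \<bullet> x) + \<gamma>" for x
    using quad_along[OF S, of b c "- u" 1 x]
    by (simp add: \<gamma>_def b u linear_neg[OF lin])
  show ?thesis
  proof (cases "k = 0")
    case True
    obtain B where B: "orthonormal B" "span B = UNIV" "\<forall>v\<in>B. \<exists>l. S v = l *\<^sub>R v"
      using selfadjoint_orthonormal_eigenbasis[OF S subspace_UNIV] by auto
    then obtain l where "\<And>v. v \<in> B \<Longrightarrow> S v = l v *\<^sub>R v" by metis
    then show ?thesis using that[OF B(1,2), of l "- u"] shift True by auto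
  next
    case False
    define w where "w = k /\<^sub>R norm k"
    have w: "norm w = 1" "S w = 0" "k = norm k *\<^sub>R w"
      using False Sk by (simp_all add: w_def linear_cmul[OF lin])
    let ?W = "{x. x \<bullet> w = 0}"
    have W: "subspace ?W" by (simp add: subspace_def inner_simps)
    \<comment> \<open>\<open>S w = 0\<close> makes the range of \<open>S\<close> orthogonal to
      \<open>w\<close>, so an eigenbasis of the hyperplane \<open>?W\<close> can be completed by
      \<open>w\<close>.\<close>
    have inv: "S x \<in> ?W" for x using w by (simp add: adj)
    obtain B where B: "orthonormal B" "span B = ?W" "\<forall>v\<in>B. \<exists>l. S v = l *\<^sub>R v"
      using selfadjoint_orthonormal_eigenbasis[OF S W inv] by auto
    have "B \<subseteq> ?W" using B(2) span_superset[of B] by simp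
    then have on: "orthonormal (insert w B)" using w B by (intro orthonormal_insert) auto
    have sp: "span (insert w B) = UNIV"
      using B w by (intro span_insert_orthogonal_complement) auto
    have "\<forall>v\<in>insert w B. \<exists>l. S v = l *\<^sub>R v" using B(3) w(2) by (auto intro: exI[of _ 0])
    then obtain l where l: "\<And>v. v \<in> insert w B \<Longrightarrow> S v = l v *\<^sub>R v" by metis
    \<comment> \<open>Moving by \<open>s\<close> along \<open>w\<close> adds
      \<open>2 * norm k * s\<close>, which cancels \<open>\<gamma>\<close>.\<close>
    define s where "s = - \<gamma> / (2 * norm k)"
    have "quad S b c ((- u + s *\<^sub>R w) + x) = x \<bullet> S x + 2 * norm k * (x \<bullet> w)" for x
    proof -
      have "quad S b c ((- u + s *\<^sub>R w) + x) = x \<bullet> S x + 2 * (k \<bullet> (s *\<^sub>R w + x)) + \<gamma>"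
        using shift[of "s *\<^sub>R w + x"] adj[of w x] w(2)
        unfolding add.assoc
        by (simp add: linear_add[OF lin] linear_cmul[OF lin] inner_simps)
      also have "k \<bullet> (s *\<^sub>R w + x) = norm k * (w \<bullet> (s *\<^sub>R w + x))"
        by (subst w(3)) simp
      also have "w \<bullet> (s *\<^sub>R w + x) = s + x \<bullet> w"
        using w(1) by (simp add: inner_simps inner_commute norm_eq_1)
      finally show ?thesis using False by (simp add: s_def algebra_simps)
    qed
    moreover have "b \<bullet> w = norm k"
    proof -
      have "k \<bullet> w = norm k" using False by (simp add: w_def power2_norm_eq_inner[symmetric] power2_eq_square)
      then show ?thesis using w(2) by (simp add: b u inner_add_left adj)
    qed
    ultimately show ?thesis
      using that[OF on sp l, of "- u + s *\<^sub>R w"] w(2) False by auto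
  qed
qed

section \<open>Obstructions to convex components\<close>

text \<open>
  The positive plane spanned by \<open>u\<close> and \<open>v\<close> contains a direction orthogonal to the gradient at
  \<open>x\<close>; up to sign it does not decrease the function at \<open>y\<close> either.
\<close>

lemma quad_pos_connected_if_index_ge_2:
  assumes S: "selfadjoint S"
    and uv: "u \<bullet> S u > 0" "v \<bullet> S v > 0" "u \<bullet> S v = 0"
    and x: "quad S b c x > 0" and y: "quad S b c y > 0"
  shows "connected_component {z. quad S b c z > 0} x y"
proof -
  have lin: "linear S" and adj: "\<And>x y. S x \<bullet> y = x \<bullet> S y"
    using S by (auto simp: selfadjoint_def)
  have form: "(\<alpha> *\<^sub>R u + \<beta> *\<^sub>R v) \<bullet> S (\<alpha> *\<^sub>R u + \<beta> *\<^sub>R v) = \<alpha>\<^sup>2 * (u \<bullet> S u) + \<beta>\<^sup>2 * (v \<bullet> S v)" for \<alpha> \<beta>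
    using uv(3) adj[of v u] by (simp add: linear_add[OF lin] linear_cmul[OF lin] inner_simps
        inner_commute power2_eq_square algebra_simps)
  let ?g = "S x + b"
  obtain \<alpha> \<beta> where ab: "\<alpha> * (?g \<bullet> u) + \<beta> * (?g \<bullet> v) = 0" "\<alpha> \<noteq> 0 \<or> \<beta> \<noteq> 0"
  proof (cases "?g \<bullet> v = 0")
    case True
    then show ?thesis using that[of 0 1] by simp
  next
    case False
    then show ?thesis using that[of "?g \<bullet> v" "- (?g \<bullet> u)"] by simp
  qed
  define w where "w = \<alpha> *\<^sub>R u + \<beta> *\<^sub>R v"
  have w: "w \<bullet> S w > 0"
    using ab(2) uv by (auto simp: w_def form intro: add_pos_nonneg add_nonneg_pos)
  moreover have "?g \<bullet> w = 0" using ab(1) by (simp add: w_def inner_add_right)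
  moreover have "- w \<bullet> S (- w) > 0" using w by (simp add: linear_neg[OF lin])
  ultimately show ?thesis
    using quad_pos_connected_component[OF S x _ y, of 0 w]
      quad_pos_connected_component[OF S x _ y, of 0 "- w"]
    by (cases "(S y + b) \<bullet> w \<ge> 0") auto
qed

text \<open>
  A line through a point of the quadric in a positive direction has both ends in the positive
  region.
\<close>

lemma quad_no_convex_component:
  assumes S: "selfadjoint S" and v: "v \<bullet> S v > 0" and x0: "quad S b c x0 = 0"
    and C: "C \<in> components {z. quad S b c z \<noteq> 0}" "convex C" "x \<in> C" "quad S b c x > 0"
    and conn: "\<And>y. quad S b c y > 0 \<Longrightarrow> connected_component {z. quad S b c z > 0} x y"
  shows False
proof -
  let ?f = "quad S b c" and ?g = "(S x0 + b) \<bullet> v"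
  \<comment> \<open>The component \<open>C\<close> contains the whole positive region.\<close>
  have sub: "y \<in> C" if "?f y > 0" for y
  proof -
    have "connected_component {z. ?f z \<noteq> 0} x y"
      by (rule connected_component_of_subset[OF conn[OF that]]) auto
    moreover obtain z where z: "C = connected_component_set {z. ?f z \<noteq> 0} z"
      using C(1) by (auto simp: components_def)
    then have "connected_component {z. ?f z \<noteq> 0} z x" using C(3) by simp
    ultimately show ?thesis unfolding z by (simp add: connected_component_trans)
  qed
  \<comment> \<open>At distance \<open>T\<close> the quadratic gain is
    \<open>T * (2 * \<bar>?g\<bar> + 1)\<close>, which beats a linear loss of at most
    \<open>2 * T * \<bar>?g\<bar>\<close>.\<close>
  define T where "T = (2 * \<bar>?g\<bar> + 1) / (v \<bullet> S v)"
  have T: "T > 0" "T * (v \<bullet> S v) = 2 * \<bar>?g\<bar> + 1" using v by (simp_all add: T_def)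
  have "x0 + t *\<^sub>R v \<in> C" if "\<bar>t\<bar> = T" for t
  proof -
    have "t\<^sup>2 = T\<^sup>2" using that by (metis power2_abs)
    then have "?f (x0 + t *\<^sub>R v) = 2 * t * ?g + T * (T * (v \<bullet> S v))"
      by (simp only: quad_along[OF S] x0 power2_eq_square[of T] mult.assoc add_0)
    moreover have "\<bar>2 * t * ?g\<bar> = T * (2 * \<bar>?g\<bar>)" using that by (simp add: abs_mult)
    moreover have "T * (T * (v \<bullet> S v)) = T * (2 * \<bar>?g\<bar>) + T"
      unfolding T(2) by (simp add: distrib_left)
    ultimately show ?thesis using T(1) by (intro sub) linarith
  qed
  from this[of T] this[of "- T"] have "x0 + T *\<^sub>R v \<in> C" "x0 + (- T) *\<^sub>R v \<in> C"
    using T(1) by simp_all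
  \<comment> \<open>The midpoint of the two far points is \<open>x0\<close> itself, a point of the
    quadric.\<close>
  from convexD[OF C(2) this, of "1/2" "1/2"]
  have "(1/2) *\<^sub>R (x0 + T *\<^sub>R v) + (1/2) *\<^sub>R (x0 + (- T) *\<^sub>R v) \<in> C" by simp
  also have "(1/2) *\<^sub>R (x0 + T *\<^sub>R v) + (1/2) *\<^sub>R (x0 + (- T) *\<^sub>R v) = (1/2) *\<^sub>R x0 + (1/2) *\<^sub>R x0"
    by (simp add: scaleR_right_distrib scaleR_diff_right)
  also have "\<dots> = x0" by (simp flip: scaleR_left_distrib)
  finally have "x0 \<in> C" .
  then have "x0 \<in> {z. ?f z \<noteq> 0}" using in_components_subset[OF C(1)] by (rule subsetD[rotated])
  then show False using x0 by simp
qed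

section \<open>Numbering an orthonormal basis\<close>

lemma bij_betw_extend_interval:
  assumes f: "bij_betw f {1..m} X" and Y: "finite Y" "X \<inter> Y = {}"
  obtains g where "\<And>i. i \<in> {1..m} \<Longrightarrow> g i = f i" "bij_betw g {m+1..m + card Y} Y"
    "bij_betw g {1..m + card Y} (X \<union> Y)"
proof -
  obtain h where h: "bij_betw h {1..card Y} Y" using ex_bij_betw_nat_finite_1[OF Y(1)] by blast
  define g where "g i = (if i \<le> m then f i else h (i - m))" for i
  have "bij_betw (\<lambda>i. i - m) {m+1..m + card Y} {1..card Y}"
    by (rule bij_betwI[where g = "\<lambda>i. i + m"]) auto
  from bij_betw_trans[OF this h] have 2: "bij_betw g {m+1..m + card Y} Y"
    by (rule bij_betw_cong[THEN iffD1, rotated]) (auto simp: g_def)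
  have 1: "bij_betw g {1..m} X"
    using f by (rule bij_betw_cong[THEN iffD1, rotated]) (auto simp: g_def)
  have "{1..m} \<union> {m+1..m + card Y} = {1..m + card Y}" by auto
  then show ?thesis
    using that[of g] 2 bij_betw_combine[OF 1 2 Y(2)] by (auto simp: g_def)
qed

text \<open>The canonical equations use initial blocks of coordinates, so \<open>X\<close> is
  numbered first, then \<open>Y\<close>, then the rest of the basis.\<close>

lemma orthonormal_enumeration:
  fixes B :: "(real^'n) set"
  assumes B: "orthonormal B" "span B = UNIV" and XY: "X \<union> Y \<subseteq> B" "X \<inter> Y = {}"
  obtains e where "orthonormal_basis e" "bij_betw e {1..CARD('n)} B" "bij_betw e {1..card X} X"
    "bij_betw e {card X + 1..card X + card Y} Y" "card X + card Y \<le> CARD('n)"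
proof -
  have fin: "finite B" "finite X" "finite Y"
    using finite_orthonormal[OF B(1)] XY(1) by (auto intro: finite_subset)
  obtain f where f: "bij_betw f {1..card X} X" using ex_bij_betw_nat_finite_1[OF fin(2)] by blast
  obtain g where g: "\<And>i. i \<in> {1..card X} \<Longrightarrow> g i = f i"
    "bij_betw g {card X + 1..card X + card Y} Y" "bij_betw g {1..card X + card Y} (X \<union> Y)"
    using bij_betw_extend_interval[OF f fin(3) XY(2)] by blast
  let ?m = "card X + card Y" and ?Z = "B - (X \<union> Y)"
  obtain e where e: "\<And>i. i \<in> {1..?m} \<Longrightarrow> e i = g i" "bij_betw e {1..?m + card ?Z} (X \<union> Y \<union> ?Z)"
    using bij_betw_extend_interval[OF g(3), of ?Z] fin(1) by blast
  have "X \<union> Y \<union> ?Z = B" using XY by auto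
  then have eB: "bij_betw e {1..?m + card ?Z} B" using e(2) by simp
  have n: "?m + card ?Z = CARD('n)"
    using bij_betw_same_card[OF eB] card_orthonormal_basis[OF B] by simp
  have eB: "bij_betw e {1..CARD('n)} B" using eB n by simp
  show ?thesis
  proof (rule that[OF _ eB])
    have "e i \<in> B" if "i \<in> {1..CARD('n)}" for i using eB that by (auto simp: bij_betw_def)
    moreover have "inj_on e {1..CARD('n)}" using eB by (simp add: bij_betw_def)
    ultimately have "e i \<bullet> e j = (if i = j then 1 else 0)"
      if "i \<in> {1..CARD('n)}" "j \<in> {1..CARD('n)}" for i j
      using orthonormal_inner[OF B(1), of "e i" "e j"] inj_onD[of e _ i j] that by presburger
    moreover have "span (e ` {1..CARD('n)}) = UNIV"
      using eB B(2) by (simp add: bij_betw_imp_surj_on)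
    ultimately show "orthonormal_basis e"
      unfolding orthonormal_basis_def by blast
    show "bij_betw e {1..card X} X"
      using f by (rule bij_betw_cong[THEN iffD1, rotated]) (simp add: e(1) g(1))
    show "bij_betw e {card X + 1..card X + card Y} Y"
      using g(2) by (rule bij_betw_cong[THEN iffD1, rotated]) (simp add: e(1))
  qed (use n in simp)
qed

text \<open>Turns weights on basis vectors into coefficients of numbered coordinates. Positivity is
  asked on all of \<open>B\<close> because the theorem asks for it at every index, also where no
  term occurs.\<close>

lemma canonical_coordinates:
  fixes B :: "(real^'n) set" and p :: "real^'n" and \<alpha> :: "real^'n \<Rightarrow> real"
  assumes B: "orthonormal B" "span B = UNIV" and XY: "X \<union> Y \<subseteq> B" "X \<inter> Y = {}"
    and \<alpha>: "\<And>v. v \<in> B \<Longrightarrow> \<alpha> v > 0"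
  obtains \<xi> a e where "cartesian_coordinates \<xi>" "\<forall>i\<in>{1..CARD('n)}. 0 < a i"
    "\<And>i x. \<xi> i x = (x - p) \<bullet> e i" "\<And>i. a i = \<alpha> (e i)"
    "bij_betw e {1..card X} X" "bij_betw e {card X + 1..card X + card Y} Y"
    "card X + card Y \<le> CARD('n)"
proof -
  obtain e where e: "orthonormal_basis e" "bij_betw e {1..CARD('n)} B" "bij_betw e {1..card X} X"
    "bij_betw e {card X + 1..card X + card Y} Y" "card X + card Y \<le> CARD('n)"
    using orthonormal_enumeration[OF B XY] by blast
  show ?thesis
  proof (rule that[OF _ _ _ _ e(3-5)])
    show "cartesian_coordinates (cartesian_coord p e)"
      using e(1) by (auto simp: cartesian_coordinates_def)
    show "\<forall>i\<in>{1..CARD('n)}. 0 < (\<alpha> \<circ> e) i"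
      using e(2) \<alpha> by (auto simp: bij_betw_def)
  qed (simp_all add: cartesian_coord_def)
qed

subsection \<open>Quadrics with a convex component\<close>

text \<open>Repeats the right-hand side of the final equivalence verbatim, so that the theorem can
  be folded with it.\<close>

definition convex_type_equation :: "(real^'n) set \<Rightarrow> bool" where
  "convex_type_equation Q \<longleftrightarrow>
     (\<exists>\<xi> a. cartesian_coordinates \<xi> \<and> (\<forall>i\<in>{1..CARD('n)}. 0 < a i) \<and>
         ((\<exists>k. 1 \<le> k \<and> k \<le> CARD('n) \<and>
             Q = {x. (\<Sum>i=1..k. a i * (\<xi> i x)\<^sup>2) = 1})
        \<or> (\<exists>k. 2 \<le> k \<and> k \<le> CARD('n) \<and>
             Q = {x. a 1 * (\<xi> 1 x)\<^sup>2 - (\<Sum>i=2..k. a i * (\<xi> i x)\<^sup>2) = 1})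
        \<or> Q = {x. a 1 * (\<xi> 1 x)\<^sup>2 = 0}
        \<or> (\<exists>k. 2 \<le> k \<and> k \<le> CARD('n) \<and>
             Q = {x. a 1 * (\<xi> 1 x)\<^sup>2 - (\<Sum>i=2..k. a i * (\<xi> i x)\<^sup>2) = 0})
        \<or> (\<exists>k. 2 \<le> k \<and> k \<le> CARD('n) \<and>
             Q = {x. (\<Sum>i=1..k - 1. a i * (\<xi> i x)\<^sup>2) = \<xi> k x})))"

lemma convex_type_equationI:
  fixes \<xi> :: "nat \<Rightarrow> real^'n \<Rightarrow> real" and a :: "nat \<Rightarrow> real"
  assumes "cartesian_coordinates \<xi>" "\<forall>i\<in>{1..CARD('n)}. 0 < a i"
    and "(\<exists>k. 1 \<le> k \<and> k \<le> CARD('n) \<and>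
             Q = {x. (\<Sum>i=1..k. a i * (\<xi> i x)\<^sup>2) = 1})
        \<or> (\<exists>k. 2 \<le> k \<and> k \<le> CARD('n) \<and>
             Q = {x. a 1 * (\<xi> 1 x)\<^sup>2 - (\<Sum>i=2..k. a i * (\<xi> i x)\<^sup>2) = 1})
        \<or> Q = {x. a 1 * (\<xi> 1 x)\<^sup>2 = 0}
        \<or> (\<exists>k. 2 \<le> k \<and> k \<le> CARD('n) \<and>
             Q = {x. a 1 * (\<xi> 1 x)\<^sup>2 - (\<Sum>i=2..k. a i * (\<xi> i x)\<^sup>2) = 0})
        \<or> (\<exists>k. 2 \<le> k \<and> k \<le> CARD('n) \<and>
             Q = {x. (\<Sum>i=1..k - 1. a i * (\<xi> i x)\<^sup>2) = \<xi> k x})"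
  shows "convex_type_equation Q"
  unfolding convex_type_equation_def
  by (rule exI[of _ \<xi>], rule exI[of _ a], intro conjI assms)

lemma convex_type_ellipsoid:
  fixes B :: "(real^'n) set"
  assumes B: "orthonormal B" "span B = UNIV" and X: "X \<subseteq> B" "X \<noteq> {}"
    and \<alpha>: "\<And>v. v \<in> B \<Longrightarrow> \<alpha> v > 0"
    and Q: "\<And>x. x \<in> Q \<longleftrightarrow> (\<Sum>v\<in>X. \<alpha> v * ((x - p) \<bullet> v)\<^sup>2) = 1"
  shows "convex_type_equation Q"
proof -
  have XY: "X \<union> {} \<subseteq> B" "X \<inter> {} = {}" using X by auto
  obtain \<xi> a e where c: "cartesian_coordinates \<xi>" "\<forall>i\<in>{1..CARD('n)}. 0 < a i"
    and \<xi>: "\<And>i x. \<xi> i x = (x - p) \<bullet> e i" and a: "\<And>i. a i = \<alpha> (e i)"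
    and e: "bij_betw e {1..card X} X" "bij_betw e {card X + 1..card X + card ({} :: (real^'n) set)} {}"
    and le: "card X + card ({} :: (real^'n) set) \<le> CARD('n)"
    using canonical_coordinates[where p = p and \<alpha> = \<alpha>, OF B XY \<alpha>] by blast
  have "finite X" by (rule finite_subset[OF X(1) finite_orthonormal[OF B(1)]])
  then have "1 \<le> card X" using X(2) by (simp add: Suc_le_eq card_gt_0_iff)
  moreover have "Q = {x. (\<Sum>i=1..card X. a i * (\<xi> i x)\<^sup>2) = 1}"
    using sum.reindex_bij_betw[OF e(1), of "\<lambda>v. \<alpha> v * ((x - p) \<bullet> v)\<^sup>2" for x] by (auto simp: Q \<xi> a)
  moreover have "card X \<le> CARD('n)" using le by simp
  ultimately show ?thesis
    by (intro convex_type_equationI[OF c(1,2)] disjI1 exI[of _ "card X"]) blast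
qed

text \<open>The right-hand sides 0 and 1 are treated together. For empty \<open>Y\<close> the
  quadric degenerates to a double hyperplane or to two parallel hyperplanes; the latter fall under
  the ellipsoidal form with \<open>k = 1\<close>.\<close>

lemma convex_type_hyperboloid:
  fixes B :: "(real^'n) set"
  assumes B: "orthonormal B" "span B = UNIV" and Y: "insert v0 Y \<subseteq> B" "v0 \<notin> Y"
    and \<alpha>: "\<And>v. v \<in> B \<Longrightarrow> \<alpha> v > 0"
    and Q: "\<And>x. x \<in> Q \<longleftrightarrow> \<alpha> v0 * ((x - p) \<bullet> v0)\<^sup>2 - (\<Sum>v\<in>Y. \<alpha> v * ((x - p) \<bullet> v)\<^sup>2) = d"
    and d: "d = 0 \<or> d = 1"
  shows "convex_type_equation Q"
proof -
  have XY: "{v0} \<union> Y \<subseteq> B" "{v0} \<inter> Y = {}" using Y by auto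
  obtain \<xi> a e where c: "cartesian_coordinates \<xi>" "\<forall>i\<in>{1..CARD('n)}. 0 < a i"
    and \<xi>: "\<And>i x. \<xi> i x = (x - p) \<bullet> e i" and a: "\<And>i. a i = \<alpha> (e i)"
    and e: "bij_betw e {1..card {v0}} {v0}" "bij_betw e {card {v0} + 1..card {v0} + card Y} Y"
    and le: "card {v0} + card Y \<le> CARD('n)"
    using canonical_coordinates[where p = p and \<alpha> = \<alpha>, OF B XY \<alpha>] by blast
  have fin: "finite Y" using XY(1) by (intro finite_subset[OF _ finite_orthonormal[OF B(1)]]) simp
  have Qeq: "Q = {x. a 1 * (\<xi> 1 x)\<^sup>2 - (\<Sum>i=2..Suc (card Y). a i * (\<xi> i x)\<^sup>2) = d}"
  proof -
    have "a 1 * (\<xi> 1 x)\<^sup>2 = \<alpha> v0 * ((x - p) \<bullet> v0)\<^sup>2" for x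
      using e(1) by (simp add: \<xi> a bij_betw_def)
    moreover have "(\<Sum>i=2..Suc (card Y). a i * (\<xi> i x)\<^sup>2) = (\<Sum>v\<in>Y. \<alpha> v * ((x - p) \<bullet> v)\<^sup>2)" for x
      using sum.reindex_bij_betw[OF e(2), of "\<lambda>v. \<alpha> v * ((x - p) \<bullet> v)\<^sup>2"]
      by (simp add: \<xi> a numeral_2_eq_2)
    ultimately show ?thesis by (intro set_eqI) (simp only: Q mem_Collect_eq diff_Suc_1)
  qed
  show ?thesis
  proof (cases "Y = {}")
    case True
    then have Q1: "Q = {x. a 1 * (\<xi> 1 x)\<^sup>2 = d}" using Qeq by simp
    show ?thesis
      using d
    proof
      assume "d = 0"
      then show ?thesis using Q1
        by (intro convex_type_equationI[OF c(1,2)] disjI2[OF disjI2[OF disjI1]]) simp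
    next
      assume "d = 1"
      then show ?thesis using Q1
        by (intro convex_type_equationI[OF c(1,2)] disjI1 exI[of _ 1]) (simp add: Suc_le_eq)
    qed
  next
    case False
    then have "2 \<le> Suc (card Y)" using fin by (simp add: Suc_le_eq card_gt_0_iff)
    moreover have "Suc (card Y) \<le> CARD('n)" using le by simp
    ultimately have ex: "\<exists>k. 2 \<le> k \<and> k \<le> CARD('n) \<and>
        Q = {x. a 1 * (\<xi> 1 x)\<^sup>2 - (\<Sum>i=2..k. a i * (\<xi> i x)\<^sup>2) = d}"
      using Qeq by blast
    show ?thesis
      using d
    proof
      assume "d = 0"
      from ex[unfolded this] show ?thesis
        by (intro convex_type_equationI[OF c(1,2)] disjI2[OF disjI2[OF disjI2[OF disjI1]]])
    next
      assume "d = 1"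
      from ex[unfolded this] show ?thesis
        by (intro convex_type_equationI[OF c(1,2)] disjI2[OF disjI1])
    qed
  qed
qed

text \<open>\<open>X\<close> is numbered before \<open>w\<close>, so the linear coordinate comes
  last. An empty \<open>X\<close>, which arises when the symmetric part of the coefficient matrix
  vanishes, leaves a hyperplane; it is recast as the zero set of a squared coordinate.\<close>

lemma convex_type_paraboloid:
  fixes B :: "(real^'n) set"
  assumes B: "orthonormal B" "span B = UNIV" and X: "insert w X \<subseteq> B" "w \<notin> X"
    and \<alpha>: "\<And>v. v \<in> B \<Longrightarrow> \<alpha> v > 0"
    and Q: "\<And>x. x \<in> Q \<longleftrightarrow> (\<Sum>v\<in>X. \<alpha> v * ((x - p) \<bullet> v)\<^sup>2) = (x - p) \<bullet> w"
  shows "convex_type_equation Q"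
proof (cases "X = {}")
  case True
  show ?thesis
  proof (rule convex_type_hyperboloid[OF B])
    show "insert w {} \<subseteq> B" "w \<notin> {}" using X by auto
    show "\<And>v. v \<in> B \<Longrightarrow> 0 < \<alpha> v" by (rule \<alpha>)
    have "\<alpha> w > 0" using \<alpha> X by auto
    then show "x \<in> Q \<longleftrightarrow> \<alpha> w * ((x - p) \<bullet> w)\<^sup>2 - (\<Sum>v\<in>{}. \<alpha> v * ((x - p) \<bullet> v)\<^sup>2) = 0" for x
      unfolding Q True by auto
  qed simp
next
  case False
  have XY: "X \<union> {w} \<subseteq> B" "X \<inter> {w} = {}" using X by auto
  obtain \<xi> a e where c: "cartesian_coordinates \<xi>" "\<forall>i\<in>{1..CARD('n)}. 0 < a i"
    and \<xi>: "\<And>i x. \<xi> i x = (x - p) \<bullet> e i" and a: "\<And>i. a i = \<alpha> (e i)"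
    and e: "bij_betw e {1..card X} X" "bij_betw e {card X + 1..card X + card {w}} {w}"
    and le: "card X + card {w} \<le> CARD('n)"
    using canonical_coordinates[where p = p and \<alpha> = \<alpha>, OF B XY \<alpha>] by blast
  have fin: "finite X" using XY(1) by (intro finite_subset[OF _ finite_orthonormal[OF B(1)]]) simp
  then have "2 \<le> Suc (card X)" using False by (simp add: Suc_le_eq card_gt_0_iff)
  moreover have "Q = {x. (\<Sum>i=1..Suc (card X) - 1. a i * (\<xi> i x)\<^sup>2) = \<xi> (Suc (card X)) x}"
  proof -
    have "(\<Sum>i=1..card X. a i * (\<xi> i x)\<^sup>2) = (\<Sum>v\<in>X. \<alpha> v * ((x - p) \<bullet> v)\<^sup>2)" for x
      using sum.reindex_bij_betw[OF e(1), of "\<lambda>v. \<alpha> v * ((x - p) \<bullet> v)\<^sup>2"] by (simp add: \<xi> a)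
    moreover have "\<xi> (Suc (card X)) x = (x - p) \<bullet> w" for x
      using e(2) by (simp add: \<xi> bij_betw_def)
    ultimately show ?thesis by (intro set_eqI) (simp only: Q mem_Collect_eq diff_Suc_1)
  qed
  moreover have "Suc (card X) \<le> CARD('n)" using le by simp
  ultimately show ?thesis
    by (intro convex_type_equationI[OF c(1,2)] disjI2 exI[of _ "Suc (card X)"]) blast

qed

text \<open>Connectedness of the positive region would contradict convexity of \<open>C\<close>.
  This leaves at most one positive eigenvector, none beside a linear term, and forces
  \<open>\<gamma> \<le> 0\<close> if there is one. The surviving canonical forms are listed ones up
  to a positive factor.\<close>

lemma convex_type_if_convex_component:
  fixes S :: "real^'n \<Rightarrow> real^'n"
  assumes S: "selfadjoint S" and Q: "Q = {x. quad S b c x = 0}" "Q \<noteq> {}"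
    and C: "C \<in> components (- Q)" "convex C" "x \<in> C" "quad S b c x > 0"
  shows "convex_type_equation Q"
proof -
  let ?f = "quad S b c"
  have lin: "linear S" and adj: "\<And>x y. S x \<bullet> y = x \<bullet> S y"
    using S by (auto simp: selfadjoint_def)
  obtain x0 where x0: "?f x0 = 0" using Q by auto
  have C': "C \<in> components {z. ?f z \<noteq> 0}" using C(1) Q(1) by (simp add: Compl_eq)
  note no_convex = quad_no_convex_component[OF S _ x0 C' C(2,3,4)]
  obtain p B l where B: "orthonormal B" "span B = UNIV" and l: "\<And>v. v \<in> B \<Longrightarrow> S v = l v *\<^sub>R v"
    and canon: "(\<exists>\<gamma>. \<forall>x. ?f (p + x) = x \<bullet> S x + \<gamma>) \<or>
     (\<exists>w\<in>B. \<exists>\<beta>>0. S w = 0 \<and> b \<bullet> w = \<beta> \<and> (\<forall>x. ?f (p + x) = x \<bullet> S x + 2 * \<beta> * (x \<bullet> w)))"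
    by (rule quad_canonical_form[OF S, of b c]) (rule that)
  have finB: "finite B" by (rule finite_orthonormal[OF B(1)])
  define P where "P = {v\<in>B. l v > 0}"
  define N where "N = {v\<in>B. l v < 0}"
  have fin: "finite P" "finite N" using finB by (simp_all add: P_def N_def)
  have form: "y \<bullet> S y = (\<Sum>v\<in>P. l v * (y \<bullet> v)\<^sup>2) - (\<Sum>v\<in>N. - l v * (y \<bullet> v)\<^sup>2)" for y
  proof -
    have "y \<bullet> S y = (\<Sum>v\<in>B. l v * (y \<bullet> v)\<^sup>2)" by (rule quadratic_form_eigenbasis[OF B lin l])
    also have "\<dots> = (\<Sum>v\<in>P \<union> N. l v * (y \<bullet> v)\<^sup>2)"
      by (rule sum.mono_neutral_right) (auto simp: finB P_def N_def not_less)
    also have "\<dots> = (\<Sum>v\<in>P. l v * (y \<bullet> v)\<^sup>2) + (\<Sum>v\<in>N. l v * (y \<bullet> v)\<^sup>2)"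
      using fin by (intro sum.union_disjoint) (auto simp: P_def N_def)
    finally show ?thesis by (simp add: sum_negf)
  qed
  have pos: "v \<bullet> S v > 0" if "v \<in> P" for v
    using that l orthonormal_inner[OF B(1), of v v] by (auto simp: P_def)
  have ortho: "u \<bullet> S v = 0" if "u \<in> P" "v \<in> P" "u \<noteq> v" for u v
    using that l orthonormal_inner[OF B(1), of u v] by (auto simp: P_def)
  \<comment> \<open>Two positive eigenvectors would span a positive plane, which makes the positive
    region connected.\<close>
  have single: "P = {v}" if "v \<in> P" for v
  proof (rule ccontr)
    assume "P \<noteq> {v}"
    with that obtain u where u: "u \<in> P" "u \<noteq> v" by blast
    show False
      by (rule no_convex[OF pos[OF that]])
        (rule quad_pos_connected_if_index_ge_2[OF S pos[OF u(1)] pos[OF that] ortho[OF u(1) that u(2)] C(4)])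
  qed
  \<comment> \<open>Dividing the equation by \<open>r\<close> normalises it. Zero eigenvalues get
    the weight 1, since every \<open>a i\<close> has to be positive.\<close>
  define \<alpha> where "\<alpha> r v = (if l v = 0 then 1 else \<bar>l v\<bar> / r)" for r v
  have \<alpha>_pos: "\<alpha> r v > 0" if "r > 0" for r v using that by (simp add: \<alpha>_def)
  have \<alpha>_N: "(\<Sum>v\<in>N. \<alpha> r v * g v) = (\<Sum>v\<in>N. - l v * g v) / r" for r and g :: "_ \<Rightarrow> real"
    unfolding sum_divide_distrib by (rule sum.cong) (auto simp: N_def \<alpha>_def)
  have inQ: "z \<in> Q \<longleftrightarrow> ?f (p + (z - p)) = 0" for z by (simp add: Q(1))
  show ?thesis
    using canon
  proof (elim disjE exE bexE conjE)
    fix \<gamma> assume \<gamma>: "\<forall>x. ?f (p + x) = x \<bullet> S x + \<gamma>"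
    show ?thesis
    proof (cases "P = {}")
      case True
      have neg: "y \<bullet> S y \<le> 0" for y
        unfolding form True by (auto simp: N_def mult_nonpos_nonneg intro!: sum_nonneg)
      have "?f (p + (x - p)) = (x - p) \<bullet> S (x - p) + \<gamma>" using \<gamma> by blast
      then have "\<gamma> > 0" using C(4) neg[of "x - p"] by simp
      \<comment> \<open>Otherwise the function would be the positive constant
        \<open>\<gamma>\<close> and the quadric empty.\<close>
      have "N \<noteq> {}"
      proof
        assume "N = {}"
        then have "?f (p + (x0 - p)) = \<gamma>" unfolding \<gamma>[rule_format] form True by simp
        then show False using x0 \<open>\<gamma> > 0\<close> by simp
      qed
      show ?thesis
      proof (rule convex_type_ellipsoid[OF B _ \<open>N \<noteq> {}\<close> \<alpha>_pos[OF \<open>\<gamma> > 0\<close>]])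
        show "N \<subseteq> B" by (auto simp: N_def)
        show "z \<in> Q \<longleftrightarrow> (\<Sum>v\<in>N. \<alpha> \<gamma> v * ((z - p) \<bullet> v)\<^sup>2) = 1" for z
          unfolding inQ \<gamma>[rule_format] form True \<alpha>_N using \<open>\<gamma> > 0\<close> by (simp add: field_simps)
      qed
    next
      case False
      then obtain v0 where v0: "v0 \<in> P" by blast
      note P = single[OF v0]
      show ?thesis
      proof (cases "\<gamma> > 0")
        case True
        \<comment> \<open>Towards \<open>p\<close> the form is scaled by a factor of at most 1 and
          stays above \<open>- \<gamma>\<close>, so the positive region is star-shaped about
          \<open>p\<close>.\<close>
        have star: "connected_component {z. ?f z > 0} y p" if "?f y > 0" for y
        proof (rule connected_component_closed_segment, rule)
          fix z assume "z \<in> closed_segment y p"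
          then obtain t where t: "0 \<le> t" "t \<le> 1" "z = (1 - t) *\<^sub>R y + t *\<^sub>R p"
            by (auto simp: in_segment)
          then have z: "z = p + (1 - t) *\<^sub>R (y - p)" by (simp add: algebra_simps)
          have "?f (p + (y - p)) = (y - p) \<bullet> S (y - p) + \<gamma>" using \<gamma> by blast
          then have q: "(y - p) \<bullet> S (y - p) > - \<gamma>" using that by simp
          have "?f z = (1 - t)\<^sup>2 * ((y - p) \<bullet> S (y - p)) + \<gamma>"
            unfolding z \<gamma>[rule_format] by (simp add: linear_cmul[OF lin] power2_eq_square)
          moreover have "(1 - t)\<^sup>2 * ((y - p) \<bullet> S (y - p)) > - \<gamma>"
          proof (cases "(y - p) \<bullet> S (y - p) \<ge> 0")
            case True
            then have "0 \<le> (1 - t)\<^sup>2 * ((y - p) \<bullet> S (y - p))" by simp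
            then show ?thesis using \<open>\<gamma> > 0\<close> by linarith
          next
            case False
            have "(1 - t)\<^sup>2 \<le> 1" using t by (simp add: power_le_one)
            then have "1 * ((y - p) \<bullet> S (y - p)) \<le> (1 - t)\<^sup>2 * ((y - p) \<bullet> S (y - p))"
              using False by (intro mult_right_mono_neg) auto
            then show ?thesis using q by simp
          qed
          ultimately show "z \<in> {z. ?f z > 0}" by simp
        qed
        have "connected_component {z. ?f z > 0} x y" if "?f y > 0" for y
          by (rule connected_component_trans[OF star[OF C(4)] connected_component_sym[OF star[OF that]]])
        from no_convex[OF pos[OF v0] this] show ?thesis by simp
      next
        case False
        \<comment> \<open>Dividing by \<open>- \<gamma>\<close> makes the right-hand side 1; for
          \<open>\<gamma> = 0\<close> there is nothing to normalise.\<close>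
        define r where "r = (if \<gamma> = 0 then 1 else - \<gamma>)"
        have r: "r > 0" using False by (simp add: r_def)
        show ?thesis
        proof (rule convex_type_hyperboloid[OF B _ _ \<alpha>_pos[OF r]])
          show "insert v0 N \<subseteq> B" "v0 \<notin> N" using v0 by (auto simp: N_def P_def)
          show "(if \<gamma> = 0 then 0 else 1) = 0 \<or> (if \<gamma> = 0 then 0 else 1) = (1::real)" by simp
          have \<alpha>0: "\<alpha> r v0 = l v0 / r" using v0 by (simp add: \<alpha>_def P_def)
          have scale: "L * s - M + \<gamma> = 0 \<longleftrightarrow> L / r * s - M / r = (if \<gamma> = 0 then 0 else 1)" for L s M
            using r by (auto simp: r_def field_simps)
          show "z \<in> Q \<longleftrightarrow> \<alpha> r v0 * ((z - p) \<bullet> v0)\<^sup>2 - (\<Sum>v\<in>N. \<alpha> r v * ((z - p) \<bullet> v)\<^sup>2)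
            = (if \<gamma> = 0 then 0 else 1)" for z
            unfolding inQ \<gamma>[rule_format] form P \<alpha>_N \<alpha>0 scale[symmetric] by simp
        qed
      qed
    qed
  next
    fix w \<beta> assume w: "w \<in> B" "\<beta> > 0" "S w = 0" "b \<bullet> w = \<beta>"
      and \<beta>: "\<forall>x. ?f (p + x) = x \<bullet> S x + 2 * \<beta> * (x \<bullet> w)"
    have "P = {}"
    proof (rule ccontr)
      assume "P \<noteq> {}"
      then obtain v0 where v0: "v0 \<in> P" by blast
      \<comment> \<open>The derivative along \<open>w\<close> is the constant
        \<open>2 * \<beta>\<close>, so pushing along \<open>w\<close> joins the whole positive
        region although \<open>w \<bullet> S w = 0\<close>.\<close>
      have "(S y + b) \<bullet> w \<ge> \<beta>" for y using w by (simp add: inner_add_left adj)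
      then have "connected_component {z. ?f z > 0} x y" if "?f y > 0" for y
        using w that by (intro quad_pos_connected_component[OF S C(4), of \<beta> w]) auto
      from no_convex[OF pos[OF v0] this] show False by simp
    qed
    have b2: "2 * \<beta> > 0" using w by simp
    show ?thesis
    proof (rule convex_type_paraboloid[OF B _ _ \<alpha>_pos[OF b2]])
      have "l w *\<^sub>R w = 0" using l[OF w(1)] w(3) by simp
      moreover have "w \<noteq> 0" using orthonormal_inner[OF B(1) w(1) w(1)] by auto
      ultimately show "insert w N \<subseteq> B" "w \<notin> N" using w(1) by (auto simp: N_def)
      show "z \<in> Q \<longleftrightarrow> (\<Sum>v\<in>N. \<alpha> (2 * \<beta>) v * ((z - p) \<bullet> v)\<^sup>2) = (z - p) \<bullet> w" for z
        unfolding inQ \<beta>[rule_format] form \<open>P = {}\<close> \<alpha>_N using b2 by (auto simp: divide_simps mult.commute[of _ "2 * \<beta>"])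
    qed
  qed
qed

section \<open>Affine functionals and solid cones\<close>

definition affine_functional :: "('a::euclidean_space \<Rightarrow> real) \<Rightarrow> bool" where
  "affine_functional g \<longleftrightarrow> (\<exists>d k. g = (\<lambda>x. d \<bullet> x + k))"

lemma affine_functional_const: "affine_functional (\<lambda>_. k)"
  unfolding affine_functional_def by (intro exI[of _ 0] exI[of _ k]) simp

lemma affine_functional_coord: "affine_functional (cartesian_coord p e i)"
  unfolding affine_functional_def
  by (intro exI[of _ "e i"] exI[of _ "- (p \<bullet> e i)"])
    (simp add: cartesian_coord_def fun_eq_iff inner_simps inner_commute)

lemma affine_functional_scale:
  assumes "affine_functional g" shows "affine_functional (\<lambda>x. r * g x)"
proof -
  obtain d k where "g = (\<lambda>x. d \<bullet> x + k)" using assms by (auto simp: affine_functional_def)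
  then show ?thesis unfolding affine_functional_def
    by (intro exI[of _ "r *\<^sub>R d"] exI[of _ "r * k"]) (simp add: fun_eq_iff algebra_simps)
qed

lemma affine_functional_add:
  assumes "affine_functional g" "affine_functional h"
  shows "affine_functional (\<lambda>x. g x + h x)"
proof -
  obtain d k d' k' where "g = (\<lambda>x. d \<bullet> x + k)" "h = (\<lambda>x. d' \<bullet> x + k')"
    using assms by (auto simp: affine_functional_def)
  then show ?thesis unfolding affine_functional_def
    by (intro exI[of _ "d + d'"] exI[of _ "k + k'"]) (simp add: fun_eq_iff inner_simps)
qed

text \<open>The set where the norm of \<open>h\<close> is below \<open>g\<close> is the preimage of
  an open Lorentz cone under an affine map. The triangle inequality makes it convex, hence
  connected; it is open and closed relative to the complement of \<open>Q\<close>, hence a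
  component.\<close>

lemma convex_component_if_lorentz_cone:
  fixes Q :: "'a::euclidean_space set"
  assumes h: "\<And>i. i \<in> I \<Longrightarrow> affine_functional (h i)" and g: "affine_functional g"
    and Q: "\<And>x. x \<in> Q \<longleftrightarrow> (\<Sum>i\<in>I. (h i x)\<^sup>2) = (g x)\<^sup>2"
    and x0: "(\<Sum>i\<in>I. (h i x0)\<^sup>2) < (g x0)\<^sup>2" "g x0 > 0"
  shows "\<exists>C\<in>components (- Q). convex C"
proof -
  let ?L = "\<lambda>x. L2_set (\<lambda>i. h i x) I"
  let ?C = "{x. ?L x < g x}"
  have cont_affine: "continuous_on UNIV f" if f: "affine_functional f" for f :: "'a \<Rightarrow> real"
  proof -
    obtain d k where "f = (\<lambda>x. d \<bullet> x + k)" using f unfolding affine_functional_def by blast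
    then show ?thesis by (auto intro!: continuous_intros)
  qed
  have comb: "f (u *\<^sub>R x + v *\<^sub>R y) = u * f x + v * f y"
    if f: "affine_functional f" "u + v = 1" for f u v x and y :: 'a
  proof -
    obtain d k where "f = (\<lambda>x. d \<bullet> x + k)" using f(1) unfolding affine_functional_def by blast
    moreover have "k = u * k + v * k" using f(2) by (simp flip: distrib_right)
    ultimately show ?thesis by (simp add: inner_simps algebra_simps)
  qed
  have cont: "continuous_on UNIV ?L"
    unfolding L2_set_def by (intro continuous_intros cont_affine h)
  have contg: "continuous_on UNIV g" by (rule cont_affine[OF g])
  have "convex ?C"
  proof (rule convexI)
    fix x y and u v :: real
    assume xy: "x \<in> ?C" "y \<in> ?C" and uv: "0 \<le> u" "0 \<le> v" "u + v = 1"
    have "?L (u *\<^sub>R x + v *\<^sub>R y) = L2_set (\<lambda>i. u * h i x + v * h i y) I"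
      by (intro L2_set_cong refl comb h uv)
    also have "\<dots> \<le> L2_set (\<lambda>i. u * h i x) I + L2_set (\<lambda>i. v * h i y) I"
      by (rule L2_set_triangle_ineq)
    also have "\<dots> = u * ?L x + v * ?L y"
      using uv by (simp add: L2_set_right_distrib)
    also have "\<dots> < u * g x + v * g y"
    \<comment> \<open>If \<open>u = 0\<close>, strictness has to come from the summand of
      \<open>y\<close>.\<close>
    proof (cases "u = 0")
      case False
      then show ?thesis using uv xy by (intro add_less_le_mono mult_strict_left_mono mult_left_mono) auto
    qed (use uv xy in auto)
    also have "\<dots> = g (u *\<^sub>R x + v *\<^sub>R y)" by (rule comb[OF g uv(3), symmetric])
    finally show "u *\<^sub>R x + v *\<^sub>R y \<in> ?C" by simp
  qed
  have L2sq: "(?L x)\<^sup>2 = (\<Sum>i\<in>I. (h i x)\<^sup>2)" for x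
    by (simp add: L2_set_def sum_nonneg)
  have x0C: "x0 \<in> ?C"
    using x0 by (auto simp: L2_set_def intro!: real_less_lsqrt)
  have sub: "?C \<subseteq> - Q"
  proof
    fix x assume "x \<in> ?C"
    then have "(?L x)\<^sup>2 < (g x)\<^sup>2" by (intro power_strict_mono) auto
    then show "x \<in> - Q" by (simp add: Q L2sq)
  qed
  have op: "open ?C" using cont contg by (intro open_Collect_less) auto
  \<comment> \<open>Equality of \<open>?L x\<close> and \<open>g x\<close> would put
    \<open>x\<close> on \<open>Q\<close>, so off \<open>Q\<close> the strict and the weak inequality
    agree.\<close>
  have C_eq: "?C = - Q \<inter> {x. ?L x \<le> g x}"
  proof
    show "?C \<subseteq> - Q \<inter> {x. ?L x \<le> g x}" using sub by auto
    show "- Q \<inter> {x. ?L x \<le> g x} \<subseteq> ?C"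
    proof
      fix x assume x: "x \<in> - Q \<inter> {x. ?L x \<le> g x}"
      then have "?L x \<noteq> g x" using L2sq[of x] Q[of x] by auto
      then show "x \<in> ?C" using x by simp
    qed
  qed
  have cl: "closed {x. ?L x \<le> g x}" using cont contg by (intro closed_Collect_le) auto
  let ?K = "connected_component_set (- Q) x0"
  have x0Q: "x0 \<in> - Q" using x0C sub by blast
  have "?C \<subseteq> ?K"
    using x0C sub \<open>convex ?C\<close> by (intro connected_component_maximal convex_connected)
  moreover have "?K \<subseteq> ?C"
  proof -
    have "?K \<inter> ?C = ?K \<inter> {x. ?L x \<le> g x}"
      using C_eq connected_component_subset[of "- Q" x0] by blast
    then have "openin (top_of_set ?K) (?K \<inter> ?C)" "closedin (top_of_set ?K) (?K \<inter> ?C)"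
      using openin_open_Int[OF op, of ?K] closedin_closed_Int[OF cl, of ?K] by simp_all
    then have disj: "?K \<inter> ?C = {} \<or> ?K \<inter> ?C = ?K"
      using connected_connected_component[of "- Q" x0] unfolding connected_clopen by blast
    have "x0 \<in> ?K \<inter> ?C" using x0C connected_component_refl[OF x0Q] by simp
    with disj have "?K \<inter> ?C = ?K" by (elim disjE) (simp only: empty_iff)
    then show ?thesis unfolding inf.absorb_iff1 .
  qed
  ultimately have "?C = ?K" by blast
  then have "?C \<in> components (- Q)" using x0Q by (auto simp: components_def)
  then show ?thesis using \<open>convex ?C\<close> by blast
qed

lemma cartesian_coordinates_witness:
  fixes \<xi> :: "nat \<Rightarrow> real^'n \<Rightarrow> real"
  assumes "cartesian_coordinates \<xi>" "j \<in> {1..CARD('n)}"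
  obtains x where "\<And>i. i \<in> {1..CARD('n)} \<Longrightarrow> \<xi> i x = (if i = j then T else 0)"
proof -
  obtain p e where e: "orthonormal_basis e" "\<xi> = cartesian_coord p e"
    using assms(1) by (auto simp: cartesian_coordinates_def)
  have "\<xi> i (p + T *\<^sub>R e j) = (if i = j then T else 0)" if "i \<in> {1..CARD('n)}" for i
    using e(1) assms(2) that by (simp add: e(2) cartesian_coord_def orthonormal_basis_def)
  then show ?thesis by (rule that)
qed

text \<open>After moving the negative terms across, \<open>d\<close> plus a sum of squares equals
  the square of \<open>sqrt (a 1) * \<xi> 1 x\<close>. Allowing \<open>k = 1\<close> includes the
  double hyperplane.\<close>

lemma convex_component_cone:
  fixes \<xi> :: "nat \<Rightarrow> real^'n \<Rightarrow> real" and d :: real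
  assumes \<xi>: "cartesian_coordinates \<xi>" and a: "\<forall>i\<in>{1..CARD('n)}. 0 < a i"
    and k: "1 \<le> k" "k \<le> CARD('n)" and d: "d = 0 \<or> d = 1"
    and Q: "Q = {x. a 1 * (\<xi> 1 x)\<^sup>2 - (\<Sum>i=2..k. a i * (\<xi> i x)\<^sup>2) = d}"
  shows "\<exists>C\<in>components (- Q). convex C"
proof -
  have aff: "affine_functional (\<xi> i)" for i
    using \<xi> affine_functional_coord by (auto simp: cartesian_coordinates_def)
  \<comment> \<open>The first coordinate goes into the other side, so index 1 is free to carry the
    constant \<open>d\<close>, whose square is \<open>d\<close> again since \<open>d\<close> is 0 or
    1.\<close>
  define h where "h i = (if i = 1 then (\<lambda>_. d) else (\<lambda>x. sqrt (a i) * \<xi> i x))" for i :: nat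
  have a1: "a 1 > 0" using a k by auto
  have sum_h: "(\<Sum>i=1..k. (h i x)\<^sup>2) = d\<^sup>2 + (\<Sum>i=2..k. a i * (\<xi> i x)\<^sup>2)" for x
  proof -
    have "(\<Sum>i=1..k. (h i x)\<^sup>2) = (h 1 x)\<^sup>2 + (\<Sum>i=2..k. (h i x)\<^sup>2)"
      using k sum.atLeast_Suc_atMost[of 1 k "\<lambda>i. (h i x)\<^sup>2"] by (simp add: numeral_2_eq_2)
    also have "(\<Sum>i=2..k. (h i x)\<^sup>2) = (\<Sum>i=2..k. a i * (\<xi> i x)\<^sup>2)"
    proof (rule sum.cong)
      fix i assume "i \<in> {2..k}"
      then show "(h i x)\<^sup>2 = a i * (\<xi> i x)\<^sup>2"
        using a k by (auto simp: h_def power_mult_distrib less_imp_le)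
    qed simp
    finally show ?thesis by (simp add: h_def)
  qed
  have "1 \<in> {1..CARD('n)}" using k by auto
  \<comment> \<open>The first coordinate is chosen to give \<open>sqrt (a 1) * \<xi> 1 x0\<close>
    the value 2, larger than both possible \<open>d\<close>.\<close>
  then obtain x0 where x0: "\<And>i. i \<in> {1..CARD('n)} \<Longrightarrow> \<xi> i x0 = (if i = 1 then 2 / sqrt (a 1) else 0)"
    using cartesian_coordinates_witness[OF \<xi>, of 1 "2 / sqrt (a 1)"] by blast
  have g0: "sqrt (a 1) * \<xi> 1 x0 = 2" using x0[of 1] a1 k by auto
  have z0: "(\<Sum>i=2..k. a i * (\<xi> i x0)\<^sup>2) = 0"
    using x0 k by (intro sum.neutral) auto
  show ?thesis
  proof (rule convex_component_if_lorentz_cone)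
    show "affine_functional (h i)" if "i \<in> {1..k}" for i
      by (simp add: h_def affine_functional_const affine_functional_scale aff)
    show "affine_functional (\<lambda>x. sqrt (a 1) * \<xi> 1 x)" by (intro affine_functional_scale aff)
    show "x \<in> Q \<longleftrightarrow> (\<Sum>i=1..k. (h i x)\<^sup>2) = (sqrt (a 1) * \<xi> 1 x)\<^sup>2" for x
      unfolding sum_h Q using d a1 by (auto simp: power_mult_distrib)
    show "(\<Sum>i=1..k. (h i x0)\<^sup>2) < (sqrt (a 1) * \<xi> 1 x0)\<^sup>2"
      unfolding sum_h g0 z0 using d by auto
    show "0 < sqrt (a 1) * \<xi> 1 x0" unfolding g0 by simp
  qed
qed

lemma convex_component_if_convex_type:
  fixes Q :: "(real^'n) set"
  assumes "convex_type_equation Q"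
  shows "\<exists>C\<in>components (- Q). convex C"
proof -
  obtain \<xi> a where \<xi>: "cartesian_coordinates \<xi>" and a: "\<forall>i\<in>{1..CARD('n)}. 0 < a i"
    and cases: "(\<exists>k. 1 \<le> k \<and> k \<le> CARD('n) \<and>
             Q = {x. (\<Sum>i=1..k. a i * (\<xi> i x)\<^sup>2) = 1})
        \<or> (\<exists>k. 2 \<le> k \<and> k \<le> CARD('n) \<and>
             Q = {x. a 1 * (\<xi> 1 x)\<^sup>2 - (\<Sum>i=2..k. a i * (\<xi> i x)\<^sup>2) = 1})
        \<or> Q = {x. a 1 * (\<xi> 1 x)\<^sup>2 = 0}
        \<or> (\<exists>k. 2 \<le> k \<and> k \<le> CARD('n) \<and>
             Q = {x. a 1 * (\<xi> 1 x)\<^sup>2 - (\<Sum>i=2..k. a i * (\<xi> i x)\<^sup>2) = 0})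
        \<or> (\<exists>k. 2 \<le> k \<and> k \<le> CARD('n) \<and>
             Q = {x. (\<Sum>i=1..k - 1. a i * (\<xi> i x)\<^sup>2) = \<xi> k x})"
    using assms unfolding convex_type_equation_def by (elim exE conjE)
  have aff: "affine_functional (\<xi> i)" for i
    using \<xi> affine_functional_coord by (auto simp: cartesian_coordinates_def)
  have one: "1 \<in> {1..CARD('n)}" by (simp add: Suc_le_eq)
  note cone = convex_component_cone[OF \<xi> a]
  show ?thesis
    using cases
  proof (elim disjE exE conjE)
    fix k assume k: "1 \<le> k" "k \<le> CARD('n)" and Q: "Q = {x. (\<Sum>i=1..k. a i * (\<xi> i x)\<^sup>2) = 1}"
    \<comment> \<open>With the value 0 the witness is the centre of the ellipsoid, whose interior is
      the cone region for the constant functional 1.\<close>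
    obtain x0 where x0: "\<And>i. i \<in> {1..CARD('n)} \<Longrightarrow> \<xi> i x0 = (if i = 1 then 0 else 0)"
      using cartesian_coordinates_witness[OF \<xi> one, of 0] by blast
    have sq: "(\<Sum>i=1..k. (sqrt (a i) * \<xi> i x)\<^sup>2) = (\<Sum>i=1..k. a i * (\<xi> i x)\<^sup>2)" for x
      using a k by (intro sum.cong) (auto simp: power_mult_distrib less_imp_le)
    have z0: "(\<Sum>i=1..k. a i * (\<xi> i x0)\<^sup>2) = 0"
      using x0 k by (intro sum.neutral) auto
    show ?thesis
    proof (rule convex_component_if_lorentz_cone)
      show "affine_functional (\<lambda>x. sqrt (a i) * \<xi> i x)" for i
        by (intro affine_functional_scale aff)
      show "affine_functional (\<lambda>_. 1)" by (rule affine_functional_const)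
      show "x \<in> Q \<longleftrightarrow> (\<Sum>i=1..k. (sqrt (a i) * \<xi> i x)\<^sup>2) = 1\<^sup>2" for x
        unfolding sq Q by simp
      show "(\<Sum>i=1..k. (sqrt (a i) * \<xi> i x0)\<^sup>2) < 1\<^sup>2" unfolding sq z0 by simp
    qed simp
  next
    fix k assume "2 \<le> k" "k \<le> CARD('n)"
      "Q = {x. a 1 * (\<xi> 1 x)\<^sup>2 - (\<Sum>i=2..k. a i * (\<xi> i x)\<^sup>2) = 1}"
    then show ?thesis by (intro cone[of k 1]) simp_all
  next
    \<comment> \<open>The double hyperplane is the cone with \<open>k = 1\<close>, where the
      subtracted sum is empty.\<close>
    assume "Q = {x. a 1 * (\<xi> 1 x)\<^sup>2 = 0}"
    then show ?thesis using one by (intro cone[of 1 0]) simp_all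
  next
    fix k assume "2 \<le> k" "k \<le> CARD('n)"
      "Q = {x. a 1 * (\<xi> 1 x)\<^sup>2 - (\<Sum>i=2..k. a i * (\<xi> i x)\<^sup>2) = 0}"
    then show ?thesis by (intro cone[of k 0]) simp_all
  next
    fix k assume k: "2 \<le> k" "k \<le> CARD('n)"
      and Q: "Q = {x. (\<Sum>i=1..k - 1. a i * (\<xi> i x)\<^sup>2) = \<xi> k x}"
    \<comment> \<open>based on \<open>t = ((t + 1) / 2)\<^sup>2 - ((t - 1) / 2)\<^sup>2\<close>\<close>
    define h where "h i = (if i = k then (\<lambda>x. (1/2) * (\<xi> k x + - 1)) else (\<lambda>x. sqrt (a i) * \<xi> i x))" for i
    have kn: "k \<in> {1..CARD('n)}" using k by auto
    \<comment> \<open>At \<open>\<xi> k x0 = 1\<close> the function \<open>h k\<close> vanishes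
      while the functional on the other side equals 1.\<close>
    obtain x0 where x0: "\<And>i. i \<in> {1..CARD('n)} \<Longrightarrow> \<xi> i x0 = (if i = k then 1 else 0)"
      using cartesian_coordinates_witness[OF \<xi> kn, of 1] by blast
    have sum_h: "(\<Sum>i=1..k. (h i x)\<^sup>2)
      = (\<Sum>i=1..k - 1. a i * (\<xi> i x)\<^sup>2) + ((1/2) * (\<xi> k x + - 1))\<^sup>2" for x
    proof -
      have "{1..k} = insert k {1..k - 1}" using k by auto
      then have "(\<Sum>i=1..k. (h i x)\<^sup>2) = (\<Sum>i=1..k - 1. (h i x)\<^sup>2) + (h k x)\<^sup>2"
        using k by simp
      also have "(\<Sum>i=1..k - 1. (h i x)\<^sup>2) = (\<Sum>i=1..k - 1. a i * (\<xi> i x)\<^sup>2)"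
      proof (rule sum.cong)
        fix i assume i: "i \<in> {1..k - 1}"
        then have "i \<noteq> k" "a i > 0" using a k by auto
        then show "(h i x)\<^sup>2 = a i * (\<xi> i x)\<^sup>2"
          by (simp add: h_def power_mult_distrib)
      qed simp
      finally show ?thesis by (simp add: h_def)
    qed
    have z0: "(\<Sum>i=1..k - 1. a i * (\<xi> i x0)\<^sup>2) = 0"
    proof (rule sum.neutral, rule)
      fix i assume "i \<in> {1..k - 1}"
      then have "i \<in> {1..CARD('n)}" "i \<noteq> k" using k by auto
      then show "a i * (\<xi> i x0)\<^sup>2 = 0" using x0[of i] by simp
    qed
    show ?thesis
    proof (rule convex_component_if_lorentz_cone)
      have "affine_functional (\<lambda>x. (1/2) * (\<xi> k x + - 1))"
        by (intro affine_functional_scale affine_functional_add affine_functional_const aff)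
      moreover have "affine_functional (\<lambda>x. sqrt (a i) * \<xi> i x)" for i
        by (intro affine_functional_scale aff)
      ultimately show "affine_functional (h i)" if "i \<in> {1..k}" for i
        by (cases "i = k") (simp_all only: h_def if_True if_False simp_thms)
      show "affine_functional (\<lambda>x. (1/2) * (\<xi> k x + 1))"
        by (intro affine_functional_scale affine_functional_add affine_functional_const aff)
      show "x \<in> Q \<longleftrightarrow> (\<Sum>i=1..k. (h i x)\<^sup>2) = ((1/2) * (\<xi> k x + 1))\<^sup>2" for x
      proof -
        have "((1/2) * (\<xi> k x + 1))\<^sup>2 = \<xi> k x + ((1/2) * (\<xi> k x + - 1))\<^sup>2"
          by (simp add: power2_eq_square field_simps)
        then show ?thesis unfolding sum_h Q by simp
      qed
      show "(\<Sum>i=1..k. (h i x0)\<^sup>2) < ((1/2) * (\<xi> k x0 + 1))\<^sup>2"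
        unfolding sum_h z0 x0[OF kn] by simp
      show "0 < (1/2) * (\<xi> k x0 + 1)" unfolding x0[OF kn] by simp
    qed
  qed
qed

section \<open>From coefficient matrices to the theorem\<close>

text \<open>\<open>x v* A\<close> is the transpose of \<open>A\<close> applied to \<open>x\<close>,
  so \<open>S\<close> is the symmetric part of \<open>A\<close>; passing to it leaves the quadratic
  form unchanged.\<close>

lemma quadric_locus_eq_quad:
  fixes A :: "real^'n^'n"
  defines "S \<equiv> \<lambda>x. (1/2) *\<^sub>R (A *v x + x v* A)"
  shows "selfadjoint S" "quadric_locus A b c = {x. quad S b c x = 0}"
proof -
  have tr: "x \<bullet> (A *v y) = (x v* A) \<bullet> y" for x y by (simp add: dot_lmul_matrix)
  show "selfadjoint S"
    unfolding selfadjoint_def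
  proof
    show "linear S"
      unfolding S_def transpose_matrix_vector[symmetric]
      by (intro linear_compose_scale_right linear_compose_add matrix_vector_mul_linear)
    show "\<forall>x y. S x \<bullet> y = x \<bullet> S y"
      by (auto simp: S_def inner_add_left inner_add_right tr inner_commute)
  qed
  have "(\<Sum>i\<in>UNIV. \<Sum>k\<in>UNIV. A $ i $ k * x $ i * x $ k) = x \<bullet> (A *v x)" for x
    by (simp add: inner_vec_def matrix_vector_mult_def sum_distrib_left mult_ac)
  moreover have "x \<bullet> S x = x \<bullet> (A *v x)" for x
    using tr[of x x] by (simp add: S_def inner_add_right inner_commute)
  moreover have "(\<Sum>i\<in>UNIV. b $ i * x $ i) = b \<bullet> x" for x by (simp add: inner_vec_def)
  ultimately show "quadric_locus A b c = {x. quad S b c x = 0}"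
    by (simp add: quadric_locus_def quad_def)
qed

theorem theorem1:
  fixes Q :: "(real^'n) set"
  assumes "CARD('n) \<ge> 2"
    and "real_quadric_surface Q"
  shows "(finite (components (- Q)) \<and> card (components (- Q)) \<le> 4
      \<and> (\<forall>C\<in>components (- Q). open C)
      \<and> - Q = \<Union>(components (- Q)))
    \<and> ((\<exists>C\<in>components (- Q). convex C) \<longleftrightarrow>
       (\<exists>\<xi> a. cartesian_coordinates \<xi> \<and> (\<forall>i\<in>{1..CARD('n)}. 0 < a i) \<and>
         ((\<exists>k. 1 \<le> k \<and> k \<le> CARD('n) \<and>
             Q = {x. (\<Sum>i=1..k. a i * (\<xi> i x)\<^sup>2) = 1})
        \<or> (\<exists>k. 2 \<le> k \<and> k \<le> CARD('n) \<and>
             Q = {x. a 1 * (\<xi> 1 x)\<^sup>2 - (\<Sum>i=2..k. a i * (\<xi> i x)\<^sup>2) = 1})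
        \<or> Q = {x. a 1 * (\<xi> 1 x)\<^sup>2 = 0}
        \<or> (\<exists>k. 2 \<le> k \<and> k \<le> CARD('n) \<and>
             Q = {x. a 1 * (\<xi> 1 x)\<^sup>2 - (\<Sum>i=2..k. a i * (\<xi> i x)\<^sup>2) = 0})
        \<or> (\<exists>k. 2 \<le> k \<and> k \<le> CARD('n) \<and>
             Q = {x. (\<Sum>i=1..k - 1. a i * (\<xi> i x)\<^sup>2) = \<xi> k x}))))"
  unfolding convex_type_equation_def[symmetric]
proof (intro conjI)
  obtain A b c where locus: "Q = quadric_locus A b c" and ne: "Q \<noteq> {}"
    using assms(2) unfolding real_quadric_surface_def quadric_surface_def by blast
  define S where "S x = (1/2) *\<^sub>R (A *v x + x v* A)" for x
  have S: "selfadjoint S" and Q: "Q = {x. quad S b c x = 0}"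
    using quadric_locus_eq_quad(1)[of A] quadric_locus_eq_quad(2)[of A b c]
    by (simp_all add: locus S_def[abs_def])
  have compl: "- Q = {x. quad S b c x \<noteq> 0}" using Q by auto
  show "finite (components (- Q))" "card (components (- Q)) \<le> 4"
    unfolding compl by (rule quad_nonzero_components[OF S])+
  have "closed Q"
    unfolding Q by (intro closed_Collect_eq continuous_on_quad[OF S] continuous_on_const)
  then show "\<forall>C\<in>components (- Q). open C"
    using open_components by blast
  show "- Q = \<Union>(components (- Q))" by (rule Union_components[symmetric])
  show "(\<exists>C\<in>components (- Q). convex C) \<longleftrightarrow> convex_type_equation Q"
  proof
    assume "\<exists>C\<in>components (- Q). convex C"
    then obtain C where C: "C \<in> components (- Q)" "convex C" by blast
    then obtain x where x: "x \<in> C" using in_components_nonempty by blast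
    have "x \<in> - Q" using C(1) x in_components_subset by blast
    \<comment> \<open>Negating all data keeps the quadric and exchanges the two sides, so one lemma
      serves both cases.\<close>
    then consider "quad S b c x > 0" | "quad (\<lambda>x. - S x) (- b) (- c) x > 0"
      unfolding compl quad_uminus by fastforce
    then show "convex_type_equation Q"
    proof cases
      case 1
      then show ?thesis by (rule convex_type_if_convex_component[OF S Q ne C x])
    next
      case 2
      have Q': "Q = {x. quad (\<lambda>x. - S x) (- b) (- c) x = 0}" by (simp add: Q quad_uminus)
      show ?thesis
        by (rule convex_type_if_convex_component[OF selfadjoint_uminus[OF S] Q' ne C x 2])
    qed
  next
    assume "convex_type_equation Q"
    then show "\<exists>C\<in>components (- Q). convex C" by (rule convex_component_if_convex_type)
  qed
qed

end
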